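(* Let $0<\alpha<2$, $0<\beta\le\alpha-1$, and $M>0$. Let $X\in\mathcal C^\beta_1([0,1],M)\cap\mathcal{CB}^\alpha_1((0,1],c(\cdot),V(\cdot))$ be a random process and let $I(X)=\int_0^1X(t)\,dt$ be approximated by the stratified Monte Carlo quadrature $I_N(X,T_N)$, where $T_N$ is $qRS(h)$. Suppose that for the density $h$ and the local Hölder function $V$ the following condition holds: $V(G(\cdot))$ and $g(\cdot)$ are bounded from above by functions $R(\cdot)$ and $r(\cdot)$, respectively, such that $R$ and $r$ satisfy the shifting condition with $C_L=1/2$, $C_U=2$; moreover, $$\int_0^1R(H(t))\,r(H(t))^{1+\alpha}\,dt<\infty\qquad\text{and}\qquad G(s)=o\bigl(s^{(1+\alpha)/(2+\beta)}\bigr)\ \text{ as }s\to0.$$ Then $$\lim_{N\to\infty}N^{1+\alpha}\|I(X)-I_N(X,T_N)\|^2=a_\alpha\int_0^1c(t)\,h(t)^{-(1+\alpha)}\,dt,\qquad a_\alpha:=\frac1{(1+\alpha)(2+\alpha)}.$$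
   Context: For a square-integrable random variable $\xi$, $\|\xi\|=(\mathrm E\,\xi^2)^{1/2}$. $X(t)$, $t\in[0,1]$, is a random process with finite second moments, continuous in quadratic mean (and taken jointly measurable). - $X\in\mathcal C^\beta_1([0,1],M)$: $\|X(t+s)-X(t)\|^2\le M|s|^\beta$ for all $t,t+s\in[0,1]$. - For an interval $\mathcal A=[a,b]$, $X\in\mathcal C^\alpha_1(\mathcal A,V(\cdot))$ (locally Hölder continuous): for all $t,t+s\in\mathcal A$, $\|X(t+s)-X(t)\|^2\le V(\bar t)|s|^\alpha$ for some $\bar t\in\{t+su:u\in[0,1]\}$, where $V$ is a positive continuous function. - $X\in\mathcal B^\alpha_1(\mathcal A,c(\cdot))$ (locally stationary): $\|X(t+s)-X(t)\|^2/(c(t)|s|^\alpha)\to1$ as $s\to0$ uniformly in $t\in\mathcal A$ (with $t,t+s\in\mathcal A$), where $c$ is positive and continuous. - $X\in\mathcal{CB}^\alpha_1((0,1],c(\cdot),V(\cdot))$: $c,V$ are positive continuous functions on $(0,1]$ and $X\in\mathcal C^\alpha_1(\mathcal A,V(\cdot))\cap\mathcal B^\alpha_1(\mathcal A,c(\cdot))$ for every closed interval $\mathcal A\subset(0,1]$. Shifting condition (dimension one). A positive function $f$ satisfies the shifting condition with constants $0<C_L<C_U$ if there exist positive constants $C$ and $a$ such that $f(s)\le Cf(v)$ for all $s,v\in(0,a]$ with $C_L\le s/v\le C_U$. Designs. $T_N$ is $qRS(h)$ (quasi regular sequence): $h$ is a positive probability density, continuous on $(0,1]$, allowed to be unbounded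 at $t=0$, in which case $h(t)\to+\infty$ as $t\to0+$ (if it is not unbounded, it is continuous on $[0,1]$ as for ordinary regular sequences). The grid points $0=t_0<t_1<\dots<t_N=1$ are given by $\int_0^{t_i}h(v)\,dv=i/N$. Set $H(t)=\int_0^th(u)\,du$, $G=H^{-1}$ on $[0,1]$ (quantile function) and $g(t)=G'(t)=1/h(G(t))$ (quantile density); $g$ is assumed continuous on $[0,1]$, with the convention $g(0)=0$ if $h(t)\to+\infty$ as $t\to0+$. Quadrature. $I_N(X,T_N)=\sum_{i=0}^{N-1}X(\eta_i)(t_{i+1}-t_i)$, where $\eta_i$ is uniformly distributed on $[t_i,t_{i+1}]$, the $\eta_i$ being mutually independent and independent of $X$. The error $\|I(X)-I_N(X,T_N)\|^2$ is the expectation over both $X$ and the $\eta_i$. *)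

theory Defs
  imports "HOL-Probability.Probability" "HOL-Library.Landau_Symbols"
begin

definition l2norm :: "'a measure \<Rightarrow> ('a \<Rightarrow> real) \<Rightarrow> real" where
  "l2norm P \<xi> = sqrt (\<integral>\<omega>. (\<xi> \<omega>)\<^sup>2 \<partial>P)"

text \<open>
  The process lives on a sub-\<open>\<sigma>\<close>-algebra \<open>F\<close> of the underlying probability space \<open>P\<close>, which may
  also carry the random quadrature nodes. \<open>F\<close> need not be the \<open>\<sigma>\<close>-algebra generated by the
  variables \<open>X t\<close>: it has to make \<open>X\<close> jointly measurable. Only values \<open>X t\<close> with
  \<open>0 \<le> t \<le> 1\<close> are relevant.
\<close>

definition second_order_process ::
    "'a measure \<Rightarrow> 'a measure \<Rightarrow> (real \<Rightarrow> 'a \<Rightarrow> real) \<Rightarrow> bool" where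
  "second_order_process P F X \<longleftrightarrow>
     subalgebra P F \<and>
     (\<lambda>(t, \<omega>). X t \<omega>) \<in> borel_measurable (restrict_space borel {0..1} \<Otimes>\<^sub>M F) \<and>
     (\<forall>t\<in>{0..1}. integrable P (\<lambda>\<omega>. (X t \<omega>)\<^sup>2)) \<and>
     (\<forall>t\<in>{0..1}. ((\<lambda>s. l2norm P (\<lambda>\<omega>. X s \<omega> - X t \<omega>)) \<longlongrightarrow> 0) (at t within {0..1}))"

definition holder_class ::
    "'a measure \<Rightarrow> (real \<Rightarrow> 'a \<Rightarrow> real) \<Rightarrow> real \<Rightarrow> real \<Rightarrow> bool" where
  "holder_class P X \<beta> M \<longleftrightarrow>
     (\<forall>t s. t \<in> {0..1} \<and> t + s \<in> {0..1} \<longrightarrow>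
        (l2norm P (\<lambda>\<omega>. X (t + s) \<omega> - X t \<omega>))\<^sup>2 \<le> M * \<bar>s\<bar> powr \<beta>)"

definition local_holder_class ::
    "'a measure \<Rightarrow> (real \<Rightarrow> 'a \<Rightarrow> real) \<Rightarrow> real \<Rightarrow> real \<Rightarrow> real \<Rightarrow> (real \<Rightarrow> real) \<Rightarrow> bool" where
  "local_holder_class P X a b \<alpha> V \<longleftrightarrow>
     continuous_on {a..b} V \<and> (\<forall>t\<in>{a..b}. 0 < V t) \<and>
     (\<forall>t s. t \<in> {a..b} \<and> t + s \<in> {a..b} \<longrightarrow>
        (\<exists>u\<in>{0..1}. (l2norm P (\<lambda>\<omega>. X (t + s) \<omega> - X t \<omega>))\<^sup>2 \<le> V (t + s * u) * \<bar>s\<bar> powr \<alpha>))"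

definition locally_stationary_class ::
    "'a measure \<Rightarrow> (real \<Rightarrow> 'a \<Rightarrow> real) \<Rightarrow> real \<Rightarrow> real \<Rightarrow> real \<Rightarrow> (real \<Rightarrow> real) \<Rightarrow> bool" where
  "locally_stationary_class P X a b \<alpha> c \<longleftrightarrow>
     continuous_on {a..b} c \<and> (\<forall>t\<in>{a..b}. 0 < c t) \<and>
     (\<forall>\<epsilon>>0. \<exists>\<delta>>0. \<forall>t s. t \<in> {a..b} \<and> t + s \<in> {a..b} \<and> 0 < \<bar>s\<bar> \<and> \<bar>s\<bar> < \<delta> \<longrightarrow>
        \<bar>(l2norm P (\<lambda>\<omega>. X (t + s) \<omega> - X t \<omega>))\<^sup>2 / (c t * \<bar>s\<bar> powr \<alpha>) - 1\<bar> < \<epsilon>)"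

definition CB_class ::
    "'a measure \<Rightarrow> (real \<Rightarrow> 'a \<Rightarrow> real) \<Rightarrow> real \<Rightarrow> (real \<Rightarrow> real) \<Rightarrow> (real \<Rightarrow> real) \<Rightarrow> bool" where
  "CB_class P X \<alpha> c V \<longleftrightarrow>
     continuous_on {0<..1} c \<and> (\<forall>t\<in>{0<..1}. 0 < c t) \<and>
     continuous_on {0<..1} V \<and> (\<forall>t\<in>{0<..1}. 0 < V t) \<and>
     (\<forall>a b. 0 < a \<and> a \<le> b \<and> b \<le> 1 \<longrightarrow>
        local_holder_class P X a b \<alpha> V \<and> locally_stationary_class P X a b \<alpha> c)"

text \<open>Functions subject to the shifting condition have domain \<open>(0, 1]\<close>.\<close>

definition shifting_condition :: "(real \<Rightarrow> real) \<Rightarrow> real \<Rightarrow> real \<Rightarrow> bool" where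
  "shifting_condition f CL CU \<longleftrightarrow>
     0 < CL \<and> CL < CU \<and> (\<forall>s\<in>{0<..1}. 0 < f s) \<and>
     (\<exists>C>0. \<exists>a>0. a \<le> 1 \<and>
        (\<forall>s\<in>{0<..a}. \<forall>v\<in>{0<..a}. CL \<le> s / v \<and> s / v \<le> CU \<longrightarrow> f s \<le> C * f v))"

definition cdf_of :: "(real \<Rightarrow> real) \<Rightarrow> real \<Rightarrow> real" where
  "cdf_of h t = (LBINT u:{0..t}. h u)"

definition quantile_of :: "(real \<Rightarrow> real) \<Rightarrow> real \<Rightarrow> real" where
  "quantile_of h = the_inv_into {0..1} (cdf_of h)"

definition quantile_density :: "(real \<Rightarrow> real) \<Rightarrow> real \<Rightarrow> real" where
  "quantile_density h s =
     (if s = 0 \<and> filterlim h at_top (at_right 0) then 0 else 1 / h (quantile_of h s))"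

definition qRS_density :: "(real \<Rightarrow> real) \<Rightarrow> bool" where
  "qRS_density h \<longleftrightarrow>
     continuous_on {0<..1} h \<and> (\<forall>t\<in>{0<..1}. 0 < h t) \<and>
     set_integrable lborel {0..1} h \<and> (LBINT t:{0..1}. h t) = 1 \<and>
     (if bounded (h ` {0<..1}) then continuous_on {0..1} h \<and> 0 < h 0
      else filterlim h at_top (at_right 0)) \<and>
     continuous_on {0..1} (quantile_density h)"

definition qRS_grid :: "(real \<Rightarrow> real) \<Rightarrow> nat \<Rightarrow> (nat \<Rightarrow> real) \<Rightarrow> bool" where
  "qRS_grid h N t \<longleftrightarrow>
     t 0 = 0 \<and> t N = 1 \<and> (\<forall>i<N. t i < t (Suc i)) \<and>
     (\<forall>i\<le>N. cdf_of h (t i) = real i / real N)"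

text \<open>
  Independence from the process means independence from the \<open>\<sigma>\<close>-algebra \<open>F\<close> for which it is
  jointly measurable. Independence from the variables \<open>X t\<close> alone would not be enough: for
  \<open>X t \<omega> = (if t = \<eta> 0 \<omega> then 1 else 0)\<close> every \<open>X t\<close> vanishes almost surely, but
  \<open>X (\<eta> 0 \<omega>) \<omega> = 1\<close>.
\<close>

definition stratified_nodes ::
    "'a measure \<Rightarrow> 'a measure \<Rightarrow> nat \<Rightarrow> (nat \<Rightarrow> real) \<Rightarrow> (nat \<Rightarrow> 'a \<Rightarrow> real) \<Rightarrow> bool" where
  "stratified_nodes P F N t \<eta> \<longleftrightarrow>
     (\<forall>i<N. \<eta> i \<in> measurable P (restrict_space borel {0..1}) \<and>
        distr P borel (\<eta> i) = uniform_measure lborel {t i..t (Suc i)}) \<and>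
     prob_space.indep_vars P (\<lambda>_. borel) \<eta> {..<N} \<and>
     prob_space.indep_set P (sets F)
       (sets (vimage_algebra (space P) (\<lambda>\<omega>. \<lambda>i\<in>{..<N}. \<eta> i \<omega>) (Pi\<^sub>M {..<N} (\<lambda>_. borel))))"

definition process_integral :: "(real \<Rightarrow> 'a \<Rightarrow> real) \<Rightarrow> 'a \<Rightarrow> real" where
  "process_integral X \<omega> = (LBINT t:{0..1}. X t \<omega>)"

definition stratified_quadrature ::
    "(real \<Rightarrow> 'a \<Rightarrow> real) \<Rightarrow> nat \<Rightarrow> (nat \<Rightarrow> real) \<Rightarrow> (nat \<Rightarrow> 'a \<Rightarrow> real) \<Rightarrow> 'a \<Rightarrow> real" where
  "stratified_quadrature X N t \<eta> \<omega> = (\<Sum>i<N. X (\<eta> i \<omega>) \<omega> * (t (Suc i) - t i))"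

end

theory Submission
  imports Defs
begin

text \<open>
  Write \<open>A\<^sub>i = [t\<^sub>i, t\<^sub>i\<^sub>+\<^sub>1]\<close> and \<open>\<Delta>\<^sub>i\<close> for its length. Conditionally on \<open>X\<close> the \<open>N\<close> local errors are
  independent and centred, and the variance of \<open>X(\<eta>\<^sub>i)\<close> is half the mean of \<open>(X(s) - X(t))\<^sup>2\<close> over
  \<open>A\<^sub>i \<times> A\<^sub>i\<close>. Hence the squared error is the sum of \<open>\<Delta>\<^sub>i\<^sup>2/2\<close> times the mean of
  \<open>\<parallel>X(s) - X(t)\<parallel>\<^sup>2\<close> over \<open>A\<^sub>i \<times> A\<^sub>i\<close>.

  The cell \<open>A\<^sub>0\<close> contributes \<open>O(G(1/N)\<^bsup>2+\<beta>\<^esup>)\<close>, which the assumption on \<open>G\<close> makes negligible. After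
  scaling by \<open>N\<^bsup>1+\<alpha>\<^esup>\<close>, the other cells contribute the integral of a step function. Since
  \<open>N \<Delta>\<^sub>i = 1/h(\<xi>\<^sub>i)\<close> for some \<open>\<xi>\<^sub>i\<close> in \<open>A\<^sub>i\<close>, local stationarity gives its pointwise limit
  \<open>a\<^sub>\<alpha> c h\<^bsup>-(1+\<alpha>)\<^esup>\<close>. For \<open>i \<ge> 1\<close> the points of \<open>[i/N, (i+1)/N]\<close> have ratios between \<open>1/2\<close> and \<open>2\<close>, so near
  \<open>0\<close> the shifting conditions dominate the step function by a multiple of
  \<open>R(H) r(H)\<^bsup>1+\<alpha>\<^esup>\<close>; away from \<open>0\<close> it is bounded. Dominated convergence concludes.
\<close>

subsection \<open>Variance of a stratified sum\<close>

text \<open>Expanding the square, the two pure terms give twice the second moment and the cross term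
  minus twice the squared mean. This trades a variance, which involves the mean, for increments of
  \<open>f\<close>, the quantity that the Hoelder and stationarity classes control.\<close>

lemma (in prob_space) double_integral_square_diff:
  fixes f :: "'a \<Rightarrow> real"
  assumes [measurable]: "f \<in> borel_measurable M" and sq: "integrable M (\<lambda>x. (f x)\<^sup>2)"
  shows "(\<integral>\<^sup>+x. \<integral>\<^sup>+y. ennreal ((f x - f y)\<^sup>2) \<partial>M \<partial>M) = ennreal (2 * variance f)"
proof -
  have f: "integrable M f"
    using square_integrable_imp_integrable[OF _ sq] by simp
  define m v where "m = expectation f" and "v = expectation (\<lambda>x. (f x)\<^sup>2)"
  have eq: "(f x - f y)\<^sup>2 = (f x)\<^sup>2 - 2 * f x * f y + (f y)\<^sup>2" for x y
    by (simp add: power2_eq_square algebra_simps)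
  have int: "integrable M (\<lambda>y. (f x - f y)\<^sup>2)" for x
    unfolding eq using f sq by simp
  have inner: "(\<integral>\<^sup>+y. ennreal ((f x - f y)\<^sup>2) \<partial>M) = ennreal ((f x)\<^sup>2 - 2 * f x * m + v)" for x
  proof -
    have "(\<integral>\<^sup>+y. ennreal ((f x - f y)\<^sup>2) \<partial>M) = ennreal (\<integral>y. (f x - f y)\<^sup>2 \<partial>M)"
      using int by (intro nn_integral_eq_integral) auto
    also have "(\<integral>y. (f x - f y)\<^sup>2 \<partial>M) = (f x)\<^sup>2 - 2 * f x * m + v"
      unfolding eq m_def v_def using f sq by (simp add: prob_space)
    finally show ?thesis .
  qed
  have nn: "0 \<le> (f x)\<^sup>2 - 2 * f x * m + v" for x
  proof -
    have "0 \<le> (\<integral>y. (f x - f y)\<^sup>2 \<partial>M)" by simp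
    also have "\<dots> = (f x)\<^sup>2 - 2 * f x * m + v"
      unfolding eq m_def v_def using f sq by (simp add: prob_space)
    finally show ?thesis .
  qed
  have "(\<integral>\<^sup>+x. ennreal ((f x)\<^sup>2 - 2 * f x * m + v) \<partial>M) = ennreal (\<integral>x. (f x)\<^sup>2 - 2 * f x * m + v \<partial>M)"
    using f sq nn by (intro nn_integral_eq_integral) auto
  also have "(\<integral>x. (f x)\<^sup>2 - 2 * f x * m + v \<partial>M) = 2 * v - 2 * m\<^sup>2"
    using f sq by (simp add: prob_space m_def v_def power2_eq_square)
  also have "\<dots> = 2 * variance f"
    using variance_eq[OF f sq] by (simp add: m_def v_def)
  finally show ?thesis by (simp add: inner)
qed

text \<open>Distinct coordinates are independent under the product measure and each
  \<open>z i\<close> is centred, so the off-diagonal terms of the expanded square vanish.\<close>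

lemma integral_sum_square_PiM:
  fixes z :: "'i \<Rightarrow> 'b \<Rightarrow> real"
  assumes fin: "finite I" and ps: "\<And>i. prob_space (U i)"
    and [measurable]: "\<And>i. i \<in> I \<Longrightarrow> z i \<in> borel_measurable (U i)"
    and sq: "\<And>i. i \<in> I \<Longrightarrow> integrable (U i) (\<lambda>x. (z i x)\<^sup>2)"
    and zero: "\<And>i. i \<in> I \<Longrightarrow> (\<integral>x. z i x \<partial>U i) = 0"
  shows "(\<integral>\<^sup>+x. ennreal ((\<Sum>i\<in>I. z i (x i))\<^sup>2) \<partial>PiM I U) = ennreal (\<Sum>i\<in>I. \<integral>x. (z i x)\<^sup>2 \<partial>U i)"
proof -
  interpret product_prob_space U
    by (intro product_prob_spaceI ps)
  have z: "integrable (U i) (z i)" if "i \<in> I" for i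
    using finite_measure.square_integrable_imp_integrable[of "U i" "z i"] sq that ps[of i]
    by (simp add: prob_space_def)
  have single: "integrable (PiM I U) (\<lambda>x. f (x i))" "(\<integral>x. f (x i) \<partial>PiM I U) = (\<integral>x. f x \<partial>U i)"
    if "i \<in> I" "integrable (U i) f" for i and f :: "'b \<Rightarrow> real"
  proof -
    have [measurable]: "(\<lambda>x. x i) \<in> measurable (PiM I U) (U i)"
      using that(1) by measurable
    have [measurable]: "f \<in> borel_measurable (U i)" using that by auto
    have d: "distr (PiM I U) (U i) (\<lambda>x. x i) = U i"
      using that ps by (intro distr_PiM_component) auto
    show "integrable (PiM I U) (\<lambda>x. f (x i))"
      using that integrable_distr_eq[of "\<lambda>x. x i" "PiM I U" "U i" f] by (simp add: d)
    show "(\<integral>x. f (x i) \<partial>PiM I U) = (\<integral>x. f x \<partial>U i)"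
      using integral_distr[of "\<lambda>x. x i" "PiM I U" "U i" f] by (simp add: d)
  qed
  have cross: "integrable (PiM I U) (\<lambda>x. z i (x i) * z j (x j))"
     "(\<integral>x. z i (x i) * z j (x j) \<partial>PiM I U) = 0" if ij: "i \<in> I" "j \<in> I" "i \<noteq> j" for i j
  proof -
    \<comment> \<open>Padding with the constant 1 turns \<open>z i * z j\<close> into a product over
      all of \<open>I\<close>, so the integral factorises; its factor at \<open>i\<close> is
      0.\<close>
    define f where "f k = (if k = i then z i else if k = j then z j else (\<lambda>_. 1))" for k
    have pr: "(\<Prod>k\<in>I. a k) = a i * a j" if "\<And>k. k \<in> I \<Longrightarrow> k \<noteq> i \<Longrightarrow> k \<noteq> j \<Longrightarrow> a k = 1" for a :: "'i \<Rightarrow> real"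
    proof -
      have "(\<Prod>k\<in>I. a k) = (\<Prod>k\<in>{i, j}. a k)"
        using ij that fin by (intro prod.mono_neutral_right) auto
      then show ?thesis using ij by simp
    qed
    have intf: "integrable (U k) (f k)" if "k \<in> I" for k
      using z that ij M.integrable_const unfolding f_def by auto
    have e: "(\<Prod>k\<in>I. f k (x k)) = z i (x i) * z j (x j)" for x
      using ij by (subst pr) (auto simp: f_def)
    have "(\<integral>x. (\<Prod>k\<in>I. f k (x k)) \<partial>PiM I U) = (\<Prod>k\<in>I. integral\<^sup>L (U k) (f k))"
      using fin intf by (rule product_integral_prod)
    also have "\<dots> = 0"
      using fin ij zero by (intro prod_zero) (auto simp: f_def intro!: bexI[of _ i])
    finally show "(\<integral>x. z i (x i) * z j (x j) \<partial>PiM I U) = 0" by (simp add: e)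
    show "integrable (PiM I U) (\<lambda>x. z i (x i) * z j (x j))"
      using product_integrable_prod[OF fin intf] by (simp add: e)
  qed
  have int: "integrable (PiM I U) (\<lambda>x. z i (x i) * z j (x j))" if "i \<in> I" "j \<in> I" for i j
    using that cross single(1)[of i "\<lambda>x. (z i x)\<^sup>2"] sq by (cases "i = j") (auto simp: power2_eq_square)
  have val: "(\<integral>x. z i (x i) * z j (x j) \<partial>PiM I U) = (if i = j then (\<integral>x. (z i x)\<^sup>2 \<partial>U i) else 0)"
    if "i \<in> I" "j \<in> I" for i j
    using that cross single(2)[of i "\<lambda>x. (z i x)\<^sup>2"] sq by (cases "i = j") (auto simp: power2_eq_square)
  have eq: "(\<Sum>i\<in>I. z i (x i))\<^sup>2 = (\<Sum>i\<in>I. \<Sum>j\<in>I. z i (x i) * z j (x j))" for x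
    by (simp add: power2_eq_square sum_product)
  have "integrable (PiM I U) (\<lambda>x. (\<Sum>i\<in>I. z i (x i))\<^sup>2)"
    unfolding eq using int by auto
  then have "(\<integral>\<^sup>+x. ennreal ((\<Sum>i\<in>I. z i (x i))\<^sup>2) \<partial>PiM I U) = ennreal (\<integral>x. (\<Sum>i\<in>I. z i (x i))\<^sup>2 \<partial>PiM I U)"
    by (intro nn_integral_eq_integral) auto
  also have "(\<integral>x. (\<Sum>i\<in>I. z i (x i))\<^sup>2 \<partial>PiM I U) = (\<Sum>i\<in>I. \<Sum>j\<in>I. \<integral>x. z i (x i) * z j (x j) \<partial>PiM I U)"
    unfolding eq using int by (simp add: Bochner_Integration.integral_sum Bochner_Integration.integrable_sum)
  also have "\<dots> = (\<Sum>i\<in>I. \<integral>x. (z i x)\<^sup>2 \<partial>U i)"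
    using fin by (simp add: val)
  finally show ?thesis .
qed

text \<open>By Tonelli the expectation of the squared \<open>U\<close>-norm of the path is finite,
  so that norm is finite almost surely.\<close>

lemma AE_square_integrable_path:
  fixes Y :: "real \<Rightarrow> 'a \<Rightarrow> real"
  assumes "prob_space U" and sets [measurable_cong]: "sets U = sets borel" and "prob_space W"
    and Y[measurable]: "(\<lambda>(t, \<omega>). Y t \<omega>) \<in> borel_measurable (borel \<Otimes>\<^sub>M W)"
    and bd: "(\<integral>\<^sup>+t. \<integral>\<^sup>+\<omega>. ennreal ((Y t \<omega>)\<^sup>2) \<partial>W \<partial>U) < \<infinity>"
  shows "AE \<omega> in W. integrable U (\<lambda>t. (Y t \<omega>)\<^sup>2)"
proof -
  interpret U: prob_space U by fact
  interpret W: prob_space W by fact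
  interpret UW: pair_sigma_finite U W by standard
  have "(\<integral>\<^sup>+\<omega>. \<integral>\<^sup>+t. ennreal ((Y t \<omega>)\<^sup>2) \<partial>U \<partial>W) = (\<integral>\<^sup>+t. \<integral>\<^sup>+\<omega>. ennreal ((Y t \<omega>)\<^sup>2) \<partial>W \<partial>U)"
    by (rule UW.Fubini') measurable
  then have "AE \<omega> in W. (\<integral>\<^sup>+t. ennreal ((Y t \<omega>)\<^sup>2) \<partial>U) \<noteq> \<infinity>"
    using bd by (intro nn_integral_PInf_AE) auto
  then show ?thesis
  proof (rule AE_mp, intro AE_I2 impI)
    fix \<omega> assume \<omega>: "\<omega> \<in> space W" "(\<integral>\<^sup>+t. ennreal ((Y t \<omega>)\<^sup>2) \<partial>U) \<noteq> \<infinity>"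
    then have [measurable]: "(\<lambda>t. Y t \<omega>) \<in> borel_measurable borel" by measurable
    show "integrable U (\<lambda>t. (Y t \<omega>)\<^sup>2)"
      using \<omega> by (intro integrableI_nonneg) (auto simp: top.not_eq_extremum)
  qed
qed

text \<open>With \<omega> frozen the nodes are independent and the local errors centred, so the
  inner integral is a sum of variances, each rewritten as a double integral of squared increments.
  Tonelli then moves the expectation over \<omega> innermost, where it becomes a mean square
  increment.\<close>

lemma stratified_mean_square_error:
  fixes Y :: "real \<Rightarrow> 'a \<Rightarrow> real" and w :: "'i \<Rightarrow> real"
  assumes fin: "finite I" and ps: "\<And>i. prob_space (U i)" and sets [measurable_cong]: "\<And>i. sets (U i) = sets borel"
    and W: "prob_space W"
    and Y[measurable]: "(\<lambda>(t, \<omega>). Y t \<omega>) \<in> borel_measurable (borel \<Otimes>\<^sub>M W)"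
    and bd: "\<And>i. i \<in> I \<Longrightarrow> (\<integral>\<^sup>+t. \<integral>\<^sup>+\<omega>. ennreal ((Y t \<omega>)\<^sup>2) \<partial>W \<partial>U i) < \<infinity>"
  shows "(\<integral>\<^sup>+\<omega>. \<integral>\<^sup>+x. ennreal ((\<Sum>i\<in>I. w i * (Y (x i) \<omega> - (\<integral>u. Y u \<omega> \<partial>U i)))\<^sup>2) \<partial>PiM I U \<partial>W) =
    (\<Sum>i\<in>I. ennreal ((w i)\<^sup>2 / 2) * (\<integral>\<^sup>+s. \<integral>\<^sup>+t. \<integral>\<^sup>+\<omega>. ennreal ((Y s \<omega> - Y t \<omega>)\<^sup>2) \<partial>W \<partial>U i \<partial>U i))"
proof -
  interpret W: prob_space W by (rule W)
  have [measurable]: "(\<lambda>t. Y t \<omega>) \<in> borel_measurable borel" if "\<omega> \<in> space W" for \<omega>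
    using that by measurable
  have swap: "(\<integral>\<^sup>+s. \<integral>\<^sup>+t. \<integral>\<^sup>+\<omega>. ennreal ((Y s \<omega> - Y t \<omega>)\<^sup>2) \<partial>W \<partial>U i \<partial>U i)
     = (\<integral>\<^sup>+\<omega>. \<integral>\<^sup>+s. \<integral>\<^sup>+t. ennreal ((Y s \<omega> - Y t \<omega>)\<^sup>2) \<partial>U i \<partial>U i \<partial>W)" (is "?l = ?r") for i
  proof -
    interpret Ui: prob_space "U i" by (rule ps)
    interpret UW: pair_sigma_finite "U i" W by standard
    \<comment> \<open>Tonelli is used twice: in (t, \<omega>) for fixed s, then in (s,
      \<omega>).\<close>
    have "?l = (\<integral>\<^sup>+s. \<integral>\<^sup>+\<omega>. \<integral>\<^sup>+t. ennreal ((Y s \<omega> - Y t \<omega>)\<^sup>2) \<partial>U i \<partial>W \<partial>U i)"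
      by (intro nn_integral_cong UW.Fubini'[symmetric]) (auto simp: space_pair_measure)
    also have "\<dots> = ?r"
      by (rule UW.Fubini'[symmetric]) measurable
    finally show ?thesis .
  qed
  have sqint: "AE \<omega> in W. \<forall>i\<in>I. integrable (U i) (\<lambda>t. (Y t \<omega>)\<^sup>2)"
    by (intro AE_finite_allI fin AE_square_integrable_path ps sets W Y bd)
  have "(\<integral>\<^sup>+\<omega>. \<integral>\<^sup>+x. ennreal ((\<Sum>i\<in>I. w i * (Y (x i) \<omega> - (\<integral>u. Y u \<omega> \<partial>U i)))\<^sup>2) \<partial>PiM I U \<partial>W) =
    (\<integral>\<^sup>+\<omega>. (\<Sum>i\<in>I. ennreal ((w i)\<^sup>2 / 2) * (\<integral>\<^sup>+s. \<integral>\<^sup>+t. ennreal ((Y s \<omega> - Y t \<omega>)\<^sup>2) \<partial>U i \<partial>U i)) \<partial>W)"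
  \<comment> \<open>The variance formula needs a path that is square integrable on every cell, so
    the integrands are compared only for almost every \<omega>.\<close>
  proof (rule nn_integral_cong_AE, rule AE_mp[OF sqint], intro AE_I2 impI)
    fix \<omega> assume \<omega>: "\<omega> \<in> space W" and sq: "\<forall>i\<in>I. integrable (U i) (\<lambda>t. (Y t \<omega>)\<^sup>2)"
    have [measurable]: "(\<lambda>t. Y t \<omega>) \<in> borel_measurable borel" using \<omega> by measurable
    define m where "m i = (\<integral>u. Y u \<omega> \<partial>U i)" for i
    have int: "integrable (U i) (\<lambda>t. Y t \<omega>)" if "i \<in> I" for i
      using finite_measure.square_integrable_imp_integrable[of "U i" "\<lambda>t. Y t \<omega>"] sq that ps[of i]
      by (simp add: prob_space_def)
    have pr: "measure (U i) (space (U i)) = 1" for i using prob_space.prob_space[OF ps] .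
    have finU: "finite_measure (U i)" for i using ps prob_space.finite_measure by blast
    have "(\<integral>\<^sup>+x. ennreal ((\<Sum>i\<in>I. w i * (Y (x i) \<omega> - m i))\<^sup>2) \<partial>PiM I U)
      = ennreal (\<Sum>i\<in>I. \<integral>x. (w i * (Y x \<omega> - m i))\<^sup>2 \<partial>U i)"
    proof (rule integral_sum_square_PiM[OF fin ps])
      fix i assume i: "i \<in> I"
      show "(\<lambda>t. w i * (Y t \<omega> - m i)) \<in> borel_measurable (U i)" by measurable
      show "integrable (U i) (\<lambda>t. (w i * (Y t \<omega> - m i))\<^sup>2)"
        using int[OF i] sq i finU[of i]
        by (simp add: power_mult_distrib power2_diff finite_measure.integrable_const)
      show "(\<integral>t. w i * (Y t \<omega> - m i) \<partial>U i) = 0"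
        using int[OF i] finU[of i] by (simp add: m_def finite_measure.integrable_const pr)
    qed
    also have "\<dots> = (\<Sum>i\<in>I. ennreal (\<integral>x. (w i * (Y x \<omega> - m i))\<^sup>2 \<partial>U i))"
      by (subst sum_ennreal) auto
    also have "\<dots> = (\<Sum>i\<in>I. ennreal ((w i)\<^sup>2 / 2) * (\<integral>\<^sup>+s. \<integral>\<^sup>+t. ennreal ((Y s \<omega> - Y t \<omega>)\<^sup>2) \<partial>U i \<partial>U i))"
    proof (rule sum.cong[OF refl])
      fix i assume i: "i \<in> I"
      have "(\<integral>\<^sup>+s. \<integral>\<^sup>+t. ennreal ((Y s \<omega> - Y t \<omega>)\<^sup>2) \<partial>U i \<partial>U i) = ennreal (2 * (\<integral>x. (Y x \<omega> - m i)\<^sup>2 \<partial>U i))"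
        unfolding m_def using sq i by (intro prob_space.double_integral_square_diff ps) auto
      moreover have "(\<integral>x. (w i * (Y x \<omega> - m i))\<^sup>2 \<partial>U i) = (w i)\<^sup>2 / 2 * (2 * (\<integral>x. (Y x \<omega> - m i)\<^sup>2 \<partial>U i))"
        by (simp add: power_mult_distrib)
      ultimately show "ennreal (\<integral>x. (w i * (Y x \<omega> - m i))\<^sup>2 \<partial>U i) =
          ennreal ((w i)\<^sup>2 / 2) * (\<integral>\<^sup>+s. \<integral>\<^sup>+t. ennreal ((Y s \<omega> - Y t \<omega>)\<^sup>2) \<partial>U i \<partial>U i)"
        by (simp only: ennreal_mult' zero_le_divide_iff zero_le_power2 zero_le_numeral simp_thms)
    qed
    finally show "(\<integral>\<^sup>+x. ennreal ((\<Sum>i\<in>I. w i * (Y (x i) \<omega> - (\<integral>u. Y u \<omega> \<partial>U i)))\<^sup>2) \<partial>PiM I U) =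
        (\<Sum>i\<in>I. ennreal ((w i)\<^sup>2 / 2) * (\<integral>\<^sup>+s. \<integral>\<^sup>+t. ennreal ((Y s \<omega> - Y t \<omega>)\<^sup>2) \<partial>U i \<partial>U i))"
      by (simp add: m_def)
  qed
  also have "\<dots> = (\<Sum>i\<in>I. ennreal ((w i)\<^sup>2 / 2) * (\<integral>\<^sup>+\<omega>. \<integral>\<^sup>+s. \<integral>\<^sup>+t. ennreal ((Y s \<omega> - Y t \<omega>)\<^sup>2) \<partial>U i \<partial>U i \<partial>W))"
  proof -
    have [measurable]: "(\<lambda>\<omega>. \<integral>\<^sup>+s. \<integral>\<^sup>+t. ennreal ((Y s \<omega> - Y t \<omega>)\<^sup>2) \<partial>U i \<partial>U i) \<in> borel_measurable W" for i
    proof -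
      interpret Ui: prob_space "U i" by (rule ps)
      show ?thesis by measurable
    qed
    show ?thesis by (subst nn_integral_sum) (auto simp: nn_integral_cmult)
  qed
  finally show ?thesis by (simp add: swap)
qed

subsection \<open>Uniform distributions on intervals\<close>

lemma has_integral_powr_shift_left:
  fixes p q b :: real
  assumes "p \<le> q" "0 < b"
  shows "((\<lambda>t. (t - p) powr b) has_integral (q - p) powr (b + 1) / (b + 1)) {p..q}"
proof -
  have "((\<lambda>t. (t - p) powr b) has_integral (q - p) powr (b + 1) / (b + 1) - (p - p) powr (b + 1) / (b + 1)) {p..q}"
  \<comment> \<open>The power rule for \<open>powr\<close> needs a positive base, which fails at t =
    p; this form of the fundamental theorem asks for the derivative only in the interior.\<close>
  proof (rule fundamental_theorem_of_calculus_interior)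
    show "((\<lambda>t. (t - p) powr (b + 1) / (b + 1)) has_vector_derivative (x - p) powr b) (at x)" if "x \<in> {p<..<q}" for x
      using that assms unfolding has_real_derivative_iff_has_vector_derivative[symmetric]
      by (auto intro!: derivative_eq_intros)
  qed (use assms in \<open>auto intro!: continuous_intros continuous_on_powr'\<close>)
  then show ?thesis by simp
qed

lemma has_integral_powr_shift_right:
  fixes p q b :: real
  assumes "p \<le> q" "0 < b"
  shows "((\<lambda>t. (q - t) powr b) has_integral (q - p) powr (b + 1) / (b + 1)) {p..q}"
proof -
  have "((\<lambda>t. (q - t) powr b) has_integral - ((q - q) powr (b + 1) / (b + 1)) - (- ((q - p) powr (b + 1) / (b + 1)))) {p..q}"
  proof (rule fundamental_theorem_of_calculus_interior)
    show "((\<lambda>t. - ((q - t) powr (b + 1) / (b + 1))) has_vector_derivative (q - x) powr b) (at x)" if "x \<in> {p<..<q}" for x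
      using that assms unfolding has_real_derivative_iff_has_vector_derivative[symmetric]
      by (auto intro!: derivative_eq_intros)
  qed (use assms in \<open>auto intro!: continuous_intros continuous_on_powr'\<close>)
  then show ?thesis by simp
qed

lemma has_integral_powr_abs_diff:
  fixes p q s b :: real
  assumes "p \<le> s" "s \<le> q" "0 < b"
  shows "((\<lambda>t. \<bar>s - t\<bar> powr b) has_integral ((s - p) powr (b + 1) + (q - s) powr (b + 1)) / (b + 1)) {p..q}"
proof -
  have "((\<lambda>t. \<bar>s - t\<bar> powr b) has_integral (s - p) powr (b + 1) / (b + 1)) {p..s}"
    by (rule has_integral_eq[OF _ has_integral_powr_shift_right]) (use assms in auto)
  moreover have "((\<lambda>t. \<bar>s - t\<bar> powr b) has_integral (q - s) powr (b + 1) / (b + 1)) {s..q}"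
    by (rule has_integral_eq[OF _ has_integral_powr_shift_left]) (use assms in \<open>auto simp: abs_real_def\<close>)
  ultimately show ?thesis
    using has_integral_combine[OF assms(1,2)] by (simp add: add_divide_distrib)
qed

lemma nn_integral_uniform_Icc:
  fixes p q :: real
  assumes "p < q" and "\<And>x. x \<in> {p..q} \<Longrightarrow> 0 \<le> f x" and "f \<in> borel_measurable borel"
    and "(f has_integral I) {p..q}"
  shows "(\<integral>\<^sup>+x. ennreal (f x) \<partial>uniform_measure lborel {p..q}) = ennreal (I / (q - p))"
proof -
  have I: "0 \<le> I" using assms(2,4) has_integral_nonneg by blast
  have "(\<integral>\<^sup>+x. ennreal (f x) \<partial>uniform_measure lborel {p..q}) = ennreal I / ennreal (q - p)"
    using assms(1,3) nn_integral_has_integral_lebesgue'[OF assms(2,4)]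
    by (subst nn_integral_uniform_measure) auto
  then show ?thesis using assms(1) I by (simp add: divide_ennreal)
qed

lemma prob_space_uniform_Icc: "p < q \<Longrightarrow> prob_space (uniform_measure lborel {p..q::real})"
  by (rule prob_space_uniform_measure) auto

lemma AE_uniform_Icc: "AE x in uniform_measure lborel {p..q::real}. x \<in> {p..q}"
  by (rule AE_uniform_measureI) auto

text \<open>The source of the limit constant: half of \<open>2 / ((b + 1) * (b + 2))\<close> at b =
  \<alpha> is \<open>1 / ((1 + \<alpha>) * (2 + \<alpha>))\<close>.\<close>

lemma mean_powr_abs_diff_uniform:
  fixes p q b :: real
  assumes "p < q" "0 < b"
  shows "(\<integral>\<^sup>+s. \<integral>\<^sup>+t. ennreal (\<bar>s - t\<bar> powr b) \<partial>uniform_measure lborel {p..q} \<partial>uniform_measure lborel {p..q})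
    = ennreal (2 * (q - p) powr b / ((b + 1) * (b + 2)))"
proof -
  let ?U = "uniform_measure lborel {p..q}"
  let ?f = "\<lambda>s. ((s - p) powr (b + 1) + (q - s) powr (b + 1)) / (b + 1) / (q - p)"
  have "(\<integral>\<^sup>+s. \<integral>\<^sup>+t. ennreal (\<bar>s - t\<bar> powr b) \<partial>?U \<partial>?U) = (\<integral>\<^sup>+s. ennreal (?f s) \<partial>?U)"
    by (rule nn_integral_cong_AE, rule AE_mp[OF AE_uniform_Icc], intro AE_I2 impI nn_integral_uniform_Icc)
       (use assms has_integral_powr_abs_diff in auto)
  also have "\<dots> = ennreal (2 * (q - p) powr (b + 2) / ((b + 1) * (b + 2)) / (q - p) / (q - p))"
  proof (rule nn_integral_uniform_Icc)
    have "(?f has_integral ((q - p) powr (b + 1 + 1) / (b + 1 + 1) + (q - p) powr (b + 1 + 1) / (b + 1 + 1)) / (b + 1) / (q - p)) {p..q}"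
      using assms by (intro has_integral_divide has_integral_add has_integral_powr_shift_left has_integral_powr_shift_right) auto
    moreover have "((q - p) powr (b + 1 + 1) / (b + 1 + 1) + (q - p) powr (b + 1 + 1) / (b + 1 + 1)) / (b + 1) / (q - p)
       = 2 * (q - p) powr (b + 2) / ((b + 1) * (b + 2)) / (q - p)"
    proof -
      have "b + 1 + 1 = b + 2" by simp
      then show ?thesis by (simp only:) (simp add: mult.commute)
    qed
    ultimately show "(?f has_integral 2 * (q - p) powr (b + 2) / ((b + 1) * (b + 2)) / (q - p)) {p..q}"
      by metis
  qed (use assms in auto)
  also have "2 * (q - p) powr (b + 2) / ((b + 1) * (b + 2)) / (q - p) / (q - p) = 2 * (q - p) powr b / ((b + 1) * (b + 2))"
    using assms by (simp add: powr_add power2_eq_square)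
  finally show ?thesis .
qed

subsection \<open>The distribution function of the density\<close>

context
  fixes h :: "real \<Rightarrow> real"
  assumes qRS: "qRS_density h"
begin

lemma qRS_densityD:
  shows "continuous_on {0<..1} h" "\<And>t. t \<in> {0<..1} \<Longrightarrow> 0 < h t" "set_integrable lborel {0..1} h"
  using qRS unfolding qRS_density_def by auto

lemma cdf_of_eq_integral:
  assumes "0 \<le> t" "t \<le> 1" shows "cdf_of h t = integral {0..t} h"
  unfolding cdf_of_def using assms
  by (intro set_borel_integral_eq_integral(2) set_integrable_subset[OF qRS_densityD(3)]) auto

lemma cdf_of_diff:
  assumes "0 \<le> s" "s \<le> t" "t \<le> 1" shows "cdf_of h t - cdf_of h s = integral {s..t} h"
proof -
  have "h integrable_on {0..t}"
    using assms by (intro set_borel_integral_eq_integral(1) set_integrable_subset[OF qRS_densityD(3)]) auto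
  then have "integral {0..s} h + integral {s..t} h = integral {0..t} h"
    using assms by (intro Henstock_Kurzweil_Integration.integral_combine) auto
  then show ?thesis using assms by (simp add: cdf_of_eq_integral)
qed

text \<open>Expresses the length of a cell of mass 1/N as 1/(N h(\<xi>)). The left end is kept
  positive because \<open>h\<close> may blow up at 0.\<close>

lemma cdf_of_mean_value:
  assumes "0 < s" "s < t" "t \<le> 1" shows "\<exists>\<xi>\<in>{s<..<t}. cdf_of h t - cdf_of h s = h \<xi> * (t - s)"
proof -
  have c: "continuous_on {s..t} h" using assms by (intro continuous_on_subset[OF qRS_densityD(1)]) auto
  have "\<exists>\<xi>\<in>{s<..<t}. integral {s..t} h - integral {s..s} h = h \<xi> * (t - s)"
    using assms integral_has_real_derivative[OF c]
    by (intro mvt_simple[of s t "\<lambda>x. integral {s..x} h" "\<lambda>x. (*) (h x)"])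
       (auto simp: has_field_derivative_def)
  then show ?thesis using assms by (simp add: cdf_of_diff)
qed

lemma cdf_of_less:
  assumes "0 \<le> s" "s < t" "t \<le> 1" shows "cdf_of h s < cdf_of h t"
proof -
  \<comment> \<open>The point s may be 0, out of reach of the mean value theorem. Hence [s, u]
    yields a weak increase, from positivity of \<open>h\<close>, and [u, t] the strict one.\<close>
  define u where "u = (s + t) / 2"
  have u: "s < u" "u < t" "0 < u" using assms by (auto simp: u_def)
  have "0 \<le> (LBINT x:{s..u}. h x)"
    unfolding set_lebesgue_integral_def
  \<comment> \<open>When \<open>h\<close> is unbounded nothing is assumed about the value
    \<open>h 0\<close>, so the point 0 is removed as a null set.\<close>
  proof (rule integral_nonneg_AE, rule AE_mp[OF AE_lborel_singleton[of 0]], intro AE_I2 impI)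
    fix x :: real assume "x \<noteq> 0"
    then show "0 \<le> indicator {s..u} x *\<^sub>R h x"
      using qRS_densityD(2)[of x] assms u by (auto simp: indicator_def less_imp_le)
  qed
  also have "(LBINT x:{s..u}. h x) = cdf_of h u - cdf_of h s"
    using assms u cdf_of_diff[of s u]
    by (subst set_borel_integral_eq_integral(2)) (auto intro!: set_integrable_subset[OF qRS_densityD(3)])
  finally have "cdf_of h s \<le> cdf_of h u" by simp
  also obtain \<xi> where "\<xi> \<in> {u<..<t}" "cdf_of h t - cdf_of h u = h \<xi> * (t - u)"
    using cdf_of_mean_value[of u t] u assms by auto
  then have "cdf_of h u < cdf_of h t"
    using qRS_densityD(2)[of \<xi>] u assms by (smt (verit) greaterThanAtMost_iff greaterThanLessThan_iff mult_pos_pos)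
  finally show ?thesis .
qed

lemma cdf_of_le: "0 \<le> s \<Longrightarrow> s \<le> t \<Longrightarrow> t \<le> 1 \<Longrightarrow> cdf_of h s \<le> cdf_of h t"
  using cdf_of_less[of s t] by (cases "s = t") auto

lemma quantile_of_cdf_of:
  assumes "0 \<le> t" "t \<le> 1" shows "quantile_of h (cdf_of h t) = t"
proof -
  have "inj_on (cdf_of h) {0..1}"
    by (rule linorder_inj_onI) (use cdf_of_less in force)+
  then show ?thesis unfolding quantile_of_def using assms by (intro the_inv_into_f_f) auto
qed

lemma cdf_of_0: "cdf_of h 0 = 0"
  by (simp add: cdf_of_eq_integral)

end

subsection \<open>The exact mean square error\<close>

lemma
  fixes f :: "real \<Rightarrow> real"
  assumes pq: "p < q" and [measurable]: "f \<in> borel_measurable borel"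
  shows integral_uniform_Icc: "(\<integral>x. f x \<partial>uniform_measure lborel {p..q}) = (LBINT x:{p..q}. f x) / (q - p)"
    and integrable_uniform_Icc_iff: "integrable (uniform_measure lborel {p..q}) f \<longleftrightarrow> set_integrable lborel {p..q} f"
proof -
  have d: "uniform_measure lborel {p..q} = density lborel (\<lambda>x. ennreal (indicator {p..q} x / (q - p)))"
    unfolding uniform_measure_def using pq
    by (intro arg_cong[where f="density lborel"] ext)
       (auto simp: indicator_def divide_ennreal simp flip: ennreal_1)
  show "(\<integral>x. f x \<partial>uniform_measure lborel {p..q}) = (LBINT x:{p..q}. f x) / (q - p)"
    unfolding d set_lebesgue_integral_def using pq by (subst integral_density) auto
  have "integrable (uniform_measure lborel {p..q}) f \<longleftrightarrow> integrable lborel (\<lambda>x. (1 / (q - p)) * (indicator {p..q} x * f x))"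
    unfolding d using pq by (subst integrable_density) auto
  also have "\<dots> \<longleftrightarrow> set_integrable lborel {p..q} f"
    unfolding set_integrable_def integrable_mult_left_iff integrable_mult_right_iff using pq by simp
  finally show "integrable (uniform_measure lborel {p..q}) f \<longleftrightarrow> set_integrable lborel {p..q} f" .
qed

section \<open>Subdivisions of an interval\<close>

lemma subdivision_mono:
  fixes t :: "nat \<Rightarrow> real"
  assumes "\<And>i. i < N \<Longrightarrow> t i < t (Suc i)" "i \<le> j" "j \<le> N"
  shows "t i \<le> t j"
  using assms(2,3)
proof (induction j)
  case (Suc j)
  then show ?case using assms(1)[of j] by (cases "i = Suc j") auto
qed simp

lemma integral_subdivision:
  fixes f :: "real \<Rightarrow> real"
  assumes int: "set_integrable lborel {t 0..t N} f" and mono: "\<And>i. i < N \<Longrightarrow> t i < t (Suc i)"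
  shows "(LBINT x:{t 0..t N}. f x) = (\<Sum>i<N. LBINT x:{t i..t (Suc i)}. f x)"
proof -
  have le: "t i \<le> t j" if "i \<le> j" "j \<le> N" for i j
    using mono that by (rule subdivision_mono)
  have "integral {t 0..t n} f = (\<Sum>i<n. integral {t i..t (Suc i)} f)" if "n \<le> N" for n
    using that
  proof (induction n)
    case (Suc n)
    have "f integrable_on {t 0..t (Suc n)}"
      using Suc.prems le[of "Suc n" N] by (intro set_borel_integral_eq_integral(1) set_integrable_subset[OF int]) auto
    then have "integral {t 0..t n} f + integral {t n..t (Suc n)} f = integral {t 0..t (Suc n)} f"
      using Suc.prems le[of 0 n] le[of n "Suc n"] by (intro Henstock_Kurzweil_Integration.integral_combine) auto
    then show ?case using Suc by simp
  qed simp
  then have "(LBINT x:{t 0..t N}. f x) = (\<Sum>i<N. integral {t i..t (Suc i)} f)"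
    using int by (simp add: set_borel_integral_eq_integral(2))
  also have "\<dots> = (\<Sum>i<N. LBINT x:{t i..t (Suc i)}. f x)"
    using le by (intro sum.cong refl set_borel_integral_eq_integral(2)[symmetric] set_integrable_subset[OF int]) auto
  finally show ?thesis .
qed

lemma l2norm_square: "(l2norm P \<xi>)\<^sup>2 = (\<integral>\<omega>. (\<xi> \<omega>)\<^sup>2 \<partial>P)"
  unfolding l2norm_def by simp

text \<open>The outcome, seen through \<open>F\<close>, is independent of the node vector, so the
  joint law is a product and expectations can be taken over the nodes with the path frozen. The
  coarser measure is essential: under \<open>P\<close> itself the nodes are functions of the
  outcome.\<close>

lemma joint_law_stratified_nodes:
  fixes P F :: "'a measure" and \<eta> :: "nat \<Rightarrow> 'a \<Rightarrow> real"
  assumes P: "prob_space P" and sub: "subalgebra P F" and N: "0 < N"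
    and nodes: "stratified_nodes P F N t \<eta>"
    and U: "\<And>i. i < N \<Longrightarrow> U i = uniform_measure lborel {t i..t (Suc i)}"
  shows "distr P (restr_to_subalg P F \<Otimes>\<^sub>M PiM {..<N} U) (\<lambda>\<omega>. (\<omega>, \<lambda>i\<in>{..<N}. \<eta> i \<omega>)) =
     restr_to_subalg P F \<Otimes>\<^sub>M PiM {..<N} U"
    and "(\<lambda>\<omega>. (\<omega>, \<lambda>i\<in>{..<N}. \<eta> i \<omega>)) \<in> measurable P (restr_to_subalg P F \<Otimes>\<^sub>M PiM {..<N} U)"
proof -
  interpret prob_space P by fact
  let ?W = "restr_to_subalg P F" and ?B = "PiM {..<N} (\<lambda>_. borel) :: (nat \<Rightarrow> real) measure"
  let ?e = "\<lambda>\<omega>. \<lambda>i\<in>{..<N}. \<eta> i \<omega>"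
  have \<eta>[measurable]: "\<eta> i \<in> borel_measurable P" if "i < N" for i
    using nodes that measurable_restrict_space2_iff unfolding stratified_nodes_def by blast
  have law: "distr P borel (\<eta> i) = U i" if "i < N" for i
    using nodes that U unfolding stratified_nodes_def by auto
  have setsB: "sets (PiM {..<N} U) = sets ?B"
    using U by (intro sets_PiM_cong) auto
  have e[measurable]: "?e \<in> measurable P ?B"
    by (intro measurable_restrict) auto
  have id[measurable]: "(\<lambda>\<omega>. \<omega>) \<in> measurable P ?W"
    by (rule measurable_from_subalg[OF sub]) (simp add: measurable_ident_sets sets_restr_to_subalg[OF sub])
  have "indep_vars (\<lambda>_. borel) \<eta> {..<N}"
    using nodes unfolding stratified_nodes_def by auto
  \<comment> \<open>\<open>0 < N\<close> keeps the index set nonempty, as this characterisation of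
    independence by the law of the vector asks.\<close>
  then have "distr P ?B ?e = PiM {..<N} (\<lambda>i. distr P borel (\<eta> i))"
    using N by (subst (asm) indep_vars_iff_distr_eq_PiM') auto
  also have "\<dots> = PiM {..<N} U"
    by (intro PiM_cong) (auto simp: law)
  finally have dB: "distr P ?B ?e = PiM {..<N} U" .
  interpret W: prob_space ?W using sub P by (rule prob_space_restr_to_subalg)
  have psB: "prob_space (distr P ?B ?e)" using e by (rule prob_space_distr)
  interpret B: prob_space "distr P ?B ?e" by fact
  have We: "(\<lambda>\<omega>. (\<omega>, ?e \<omega>)) \<in> measurable P (?W \<Otimes>\<^sub>M ?B)" by measurable
  have ind: "indep_set (sets F) (sets (vimage_algebra (space P) ?e ?B))"
    using nodes unfolding stratified_nodes_def by auto
  \<comment> \<open>\<open>indep_var\<close> forces both variables to have the same range type, so the product law is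
    checked on rectangles.\<close>
  have "?W \<Otimes>\<^sub>M distr P ?B ?e = distr P (?W \<Otimes>\<^sub>M ?B) (\<lambda>\<omega>. (\<omega>, ?e \<omega>))"
  proof (rule pair_measure_eqI)
    show "sets (?W \<Otimes>\<^sub>M distr P ?B ?e) = sets (distr P (?W \<Otimes>\<^sub>M ?B) (\<lambda>\<omega>. (\<omega>, ?e \<omega>)))"
      unfolding sets_distr by (intro sets_pair_measure_cong) simp_all
    fix A B assume A: "A \<in> sets ?W" and "B \<in> sets (distr P ?B ?e)"
    then have B: "B \<in> sets ?B" and AF: "A \<in> sets F" by (simp_all add: sets_restr_to_subalg[OF sub])
    have AP: "A \<subseteq> space P"
      using sets.sets_into_space[OF A] by (simp add: space_restr_to_subalg)
    have "?e -` B \<inter> space P \<in> sets (vimage_algebra (space P) ?e ?B)"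
      using B by (rule in_vimage_algebra)
    then have "prob (A \<inter> (?e -` B \<inter> space P)) = prob A * prob (?e -` B \<inter> space P)"
      using indep_setD[OF ind AF] by blast
    moreover have "(\<lambda>\<omega>. (\<omega>, ?e \<omega>)) -` (A \<times> B) \<inter> space P = A \<inter> (?e -` B \<inter> space P)"
      using AP by blast
    ultimately show "emeasure ?W A * emeasure (distr P ?B ?e) B =
        emeasure (distr P (?W \<Otimes>\<^sub>M ?B) (\<lambda>\<omega>. (\<omega>, ?e \<omega>))) (A \<times> B)"
      using A B AF We e sub
      by (simp only: emeasure_distr pair_measureI emeasure_restr_to_subalg emeasure_eq_measure ennreal_mult'[symmetric] measure_nonneg)
  qed (rule W.sigma_finite_measure_axioms B.sigma_finite_measure_axioms)+
  then have "?W \<Otimes>\<^sub>M PiM {..<N} U = distr P (?W \<Otimes>\<^sub>M ?B) (\<lambda>\<omega>. (\<omega>, ?e \<omega>))"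
    by (simp only: dB)
  also have "\<dots> = distr P (?W \<Otimes>\<^sub>M PiM {..<N} U) (\<lambda>\<omega>. (\<omega>, ?e \<omega>))"
    by (intro distr_cong sets_pair_measure_cong) (auto simp: setsB)
  finally show "distr P (?W \<Otimes>\<^sub>M PiM {..<N} U) (\<lambda>\<omega>. (\<omega>, ?e \<omega>)) = ?W \<Otimes>\<^sub>M PiM {..<N} U" by simp
  note We
  also have "measurable P (?W \<Otimes>\<^sub>M ?B) = measurable P (?W \<Otimes>\<^sub>M PiM {..<N} U)"
    by (intro measurable_cong_sets sets_pair_measure_cong) (auto simp: setsB)
  finally show "(\<lambda>\<omega>. (\<omega>, ?e \<omega>)) \<in> measurable P (?W \<Otimes>\<^sub>M PiM {..<N} U)" .
qed

text \<open>The mean is formed in the extended nonnegative reals. An infinite mean would be read as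
  0, so a lower bound on this quantity needs a finite upper bound as well.\<close>

definition mean_square_increment :: "'a measure \<Rightarrow> (real \<Rightarrow> 'a \<Rightarrow> real) \<Rightarrow> real \<Rightarrow> real \<Rightarrow> real" where
  "mean_square_increment P X p q = enn2real (\<integral>\<^sup>+s. \<integral>\<^sup>+t. ennreal ((l2norm P (\<lambda>\<omega>. X s \<omega> - X t \<omega>))\<^sup>2)
     \<partial>uniform_measure lborel {p..q} \<partial>uniform_measure lborel {p..q})"

lemma holder_class_increment_le:
  assumes "holder_class P X \<beta> M" "s \<in> {0..1}" "t \<in> {0..1}"
  shows "(l2norm P (\<lambda>\<omega>. X s \<omega> - X t \<omega>))\<^sup>2 \<le> M * \<bar>s - t\<bar> powr \<beta>"
  using assms(1)[unfolded holder_class_def, rule_format, of t "s - t"] assms(2,3) by auto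

text \<open>The identity is exact for every N: the error is a sum of centred local errors,
  independent given the path. The global Hoelder bound gives second moments bounded uniformly in
  time, which makes almost every path square integrable and the means finite.\<close>

lemma stratified_quadrature_error:
  fixes P F :: "'a measure" and X :: "real \<Rightarrow> 'a \<Rightarrow> real"
  assumes P: "prob_space P" and proc: "second_order_process P F X" and H: "holder_class P X \<beta> M"
    and \<beta>: "0 \<le> \<beta>" and M: "0 \<le> M"
    and N: "0 < N" and t: "t 0 = 0" "t N = 1" "\<And>i. i < N \<Longrightarrow> t i < t (Suc i)"
    and nodes: "stratified_nodes P F N t \<eta>"
  shows "(l2norm P (\<lambda>\<omega>. process_integral X \<omega> - stratified_quadrature X N t \<eta> \<omega>))\<^sup>2 =
    (\<Sum>i<N. (t (Suc i) - t i)\<^sup>2 / 2 * mean_square_increment P X (t i) (t (Suc i)))"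
proof -
  interpret P: prob_space P by fact
  define W where "W = restr_to_subalg P F"
  \<comment> \<open>Clamping time to [0, 1] makes the process jointly measurable on the whole line,
    matching the Borel sets of the uniform measures; on [0, 1] nothing changes.\<close>
  define Y where "Y s = X (max 0 (min 1 s))" for s
  \<comment> \<open>The values from N on make \<open>U\<close> a probability measure at every index,
    as the product lemmas ask; \<open>U N\<close>, uniform on [0, 1], also serves to integrate whole
    paths.\<close>
  define U where "U i = (if i < N then uniform_measure lborel {t i..t (Suc i)} else uniform_measure lborel {0..1})" for i
  define w where "w i = t (Suc i) - t i" for i
  have sub: "subalgebra P F" using proc by (simp add: second_order_process_def)
  have setsW[measurable_cong]: "sets W = sets F" and spW: "space W = space P"
    unfolding W_def using sub by (simp_all add: sets_restr_to_subalg space_restr_to_subalg)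
  have psW: "prob_space W" unfolding W_def using sub P by (rule prob_space_restr_to_subalg)
  interpret W: prob_space W by fact
  have psU: "prob_space (U i)" for i
    unfolding U_def using t(3) by (auto intro!: prob_space_uniform_Icc)
  have setsU[measurable_cong]: "sets (U i) = sets borel" for i unfolding U_def by simp
  have le: "t i \<le> t j" if "i \<le> j" "j \<le> N" for i j
    using t(3) that by (rule subdivision_mono)
  have t01: "{t i..t (Suc i)} \<subseteq> {0..1}" if "i < N" for i
    using le[of 0 i] le[of "Suc i" N] that t by auto
  have AEU: "AE s in U i. s \<in> {0..1}" for i
  proof (cases "i < N")
    case True
    have "AE s in U i. s \<in> {t i..t (Suc i)}"
      using True AE_uniform_Icc[of "t i" "t (Suc i)"] unfolding U_def by simp
    then show ?thesis by eventually_elim (use t01[OF True] in auto)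
  next
    case False
    then show ?thesis using AE_uniform_Icc[of 0 1] unfolding U_def by simp
  qed
  have YX: "Y s = X s" if "s \<in> {0..1}" for s using that by (auto simp: Y_def)
  have Ym[measurable]: "(\<lambda>(s, \<omega>). Y s \<omega>) \<in> borel_measurable (borel \<Otimes>\<^sub>M W)"
  proof -
    have X: "(\<lambda>(t, \<omega>). X t \<omega>) \<in> borel_measurable (restrict_space borel {0..1} \<Otimes>\<^sub>M F)"
      using proc by (simp add: second_order_process_def)
    have "(\<lambda>z. (max 0 (min 1 (fst z)), snd z)) \<in> measurable (borel \<Otimes>\<^sub>M W) (restrict_space borel {0..1::real} \<Otimes>\<^sub>M F)"
      by (intro measurable_Pair measurable_restrict_space2) (auto simp: setsW)
    from measurable_compose[OF this X] show ?thesis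
      by (simp add: Y_def case_prod_beta)
  qed
  have YW[measurable]: "Y s \<in> borel_measurable W" for s
    by measurable
  have YF[measurable]: "Y s \<in> borel_measurable F" for s
    using YW measurable_cong_sets[OF setsW refl] by blast
  have YP[measurable]: "Y s \<in> borel_measurable P" for s
    using measurable_from_subalg[OF sub YF] .
  have sqY: "integrable P (\<lambda>\<omega>. (Y s \<omega>)\<^sup>2)" for s
    using proc unfolding second_order_process_def Y_def by auto
  have sqd: "integrable P (\<lambda>\<omega>. (Y s \<omega> - Y t \<omega>)\<^sup>2)" for s t
  proof (rule Bochner_Integration.integrable_bound)
    show "integrable P (\<lambda>\<omega>. 2 * (Y s \<omega>)\<^sup>2 + 2 * (Y t \<omega>)\<^sup>2)" using sqY by auto
    have "(a - b)\<^sup>2 \<le> 2 * a\<^sup>2 + 2 * b\<^sup>2" for a b :: real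
      using zero_le_power2[of "a + b"] by (simp add: power2_eq_square algebra_simps)
    then show "AE \<omega> in P. norm ((Y s \<omega> - Y t \<omega>)\<^sup>2) \<le> norm (2 * (Y s \<omega>)\<^sup>2 + 2 * (Y t \<omega>)\<^sup>2)" by auto
  qed measurable
  have inner: "(\<integral>\<^sup>+\<omega>. ennreal ((Y s \<omega> - Y t \<omega>)\<^sup>2) \<partial>W) = ennreal ((l2norm P (\<lambda>\<omega>. X s \<omega> - X t \<omega>))\<^sup>2)"
    if "s \<in> {0..1}" "t \<in> {0..1}" for s t
  proof -
    have "(\<integral>\<^sup>+\<omega>. ennreal ((Y s \<omega> - Y t \<omega>)\<^sup>2) \<partial>W) = (\<integral>\<^sup>+\<omega>. ennreal ((Y s \<omega> - Y t \<omega>)\<^sup>2) \<partial>P)"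
      unfolding W_def by (intro nn_integral_subalgebra2 sub) measurable
    also have "\<dots> = ennreal (\<integral>\<omega>. (Y s \<omega> - Y t \<omega>)\<^sup>2 \<partial>P)"
      using sqd by (intro nn_integral_eq_integral) auto
    finally show ?thesis using that by (simp add: l2norm_square YX)
  qed
  have incr_le: "(l2norm P (\<lambda>\<omega>. X s \<omega> - X t \<omega>))\<^sup>2 \<le> M" if "s \<in> {0..1}" "t \<in> {0..1}" for s t
  proof -
    have "\<bar>s - t\<bar> powr \<beta> \<le> 1" using that \<beta> by (intro powr_le1) auto
    then show ?thesis
      using holder_class_increment_le[OF H that] mult_left_mono[OF _ M, of "\<bar>s - t\<bar> powr \<beta>" 1] by simp
  qed
  \<comment> \<open>Second moments are bounded uniformly in time by comparison with time 0, since
    the mean square increment from there is at most M.\<close>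
  have bd: "(\<integral>\<^sup>+s. \<integral>\<^sup>+\<omega>. ennreal ((Y s \<omega>)\<^sup>2) \<partial>W \<partial>U i) < \<infinity>" for i
  proof -
    have "(\<integral>\<^sup>+\<omega>. ennreal ((Y s \<omega>)\<^sup>2) \<partial>W) \<le> ennreal (2 * (\<integral>\<omega>. (Y 0 \<omega>)\<^sup>2 \<partial>P) + 2 * M)" if s: "s \<in> {0..1}" for s
    proof -
      have "(\<integral>\<^sup>+\<omega>. ennreal ((Y s \<omega>)\<^sup>2) \<partial>W) = (\<integral>\<^sup>+\<omega>. ennreal ((Y s \<omega>)\<^sup>2) \<partial>P)"
        unfolding W_def by (intro nn_integral_subalgebra2 sub) measurable
      also have "\<dots> = ennreal (\<integral>\<omega>. (Y s \<omega>)\<^sup>2 \<partial>P)"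
        using sqY by (intro nn_integral_eq_integral) auto
      also have "\<dots> \<le> ennreal (\<integral>\<omega>. 2 * (Y 0 \<omega>)\<^sup>2 + 2 * (Y s \<omega> - Y 0 \<omega>)\<^sup>2 \<partial>P)"
      proof (intro ennreal_leI integral_mono)
        have "a\<^sup>2 \<le> 2 * b\<^sup>2 + 2 * (a - b)\<^sup>2" for a b :: real
          using zero_le_power2[of "a - 2 * b"] by (simp add: power2_eq_square algebra_simps)
        then show "(Y s \<omega>)\<^sup>2 \<le> 2 * (Y 0 \<omega>)\<^sup>2 + 2 * (Y s \<omega> - Y 0 \<omega>)\<^sup>2" for \<omega> .
      qed (use sqY sqd in auto)
      also have "(\<integral>\<omega>. 2 * (Y 0 \<omega>)\<^sup>2 + 2 * (Y s \<omega> - Y 0 \<omega>)\<^sup>2 \<partial>P) = 2 * (\<integral>\<omega>. (Y 0 \<omega>)\<^sup>2 \<partial>P) + 2 * (\<integral>\<omega>. (Y s \<omega> - Y 0 \<omega>)\<^sup>2 \<partial>P)"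
        using sqY sqd by simp
      also have "(\<integral>\<omega>. (Y s \<omega> - Y 0 \<omega>)\<^sup>2 \<partial>P) \<le> M"
        using incr_le[OF s, of 0] s by (simp add: l2norm_square YX)
      finally show ?thesis by (auto simp: ennreal_leI)
    qed
    then have "(\<integral>\<^sup>+s. \<integral>\<^sup>+\<omega>. ennreal ((Y s \<omega>)\<^sup>2) \<partial>W \<partial>U i) \<le> (\<integral>\<^sup>+s. ennreal (2 * (\<integral>\<omega>. (Y 0 \<omega>)\<^sup>2 \<partial>P) + 2 * M) \<partial>U i)"
      by (intro nn_integral_mono_AE eventually_mono[OF AEU]) auto
    also have "\<dots> < \<infinity>"
      using prob_space.emeasure_space_1[OF psU] by simp
    finally show ?thesis .
  qed
  \<comment> \<open>Additivity over the cells needs an integrable path, which holds almost surely by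
    square integrability under \<open>U N\<close>. Each cell integral is the cell length times the
    mean under \<open>U i\<close>.\<close>
  have paths: "AE \<omega> in P. process_integral X \<omega> = (\<Sum>i<N. w i * (\<integral>u. Y u \<omega> \<partial>U i))"
  proof -
    have "AE \<omega> in W. integrable (U N) (\<lambda>t. (Y t \<omega>)\<^sup>2)"
      by (intro AE_square_integrable_path psU psW setsU Ym bd)
    then have "AE \<omega> in P. integrable (U N) (\<lambda>t. (Y t \<omega>)\<^sup>2)"
      unfolding W_def by (rule AE_restr_to_subalg[OF sub])
    then show ?thesis
    proof (rule AE_mp, intro AE_I2 impI)
      fix \<omega> assume "\<omega> \<in> space P" and sq: "integrable (U N) (\<lambda>t. (Y t \<omega>)\<^sup>2)"
      then have "\<omega> \<in> space W" by (simp add: spW)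
      then have [measurable]: "(\<lambda>t. Y t \<omega>) \<in> borel_measurable borel" by measurable
      have "integrable (U N) (\<lambda>t. Y t \<omega>)"
        using finite_measure.square_integrable_imp_integrable[of "U N" "\<lambda>t. Y t \<omega>"] sq psU[of N]
        by (simp add: prob_space_def)
      then have int: "set_integrable lborel {t 0..t N} (\<lambda>t. Y t \<omega>)"
        by (simp add: U_def integrable_uniform_Icc_iff t)
      have "process_integral X \<omega> = (LBINT s:{t 0..t N}. Y s \<omega>)"
        unfolding process_integral_def t(1,2) by (intro set_lebesgue_integral_cong) (auto simp: YX)
      also have "\<dots> = (\<Sum>i<N. LBINT s:{t i..t (Suc i)}. Y s \<omega>)"
        using int t(3) by (rule integral_subdivision)
      also have "\<dots> = (\<Sum>i<N. w i * (\<integral>u. Y u \<omega> \<partial>U i))"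
      proof (rule sum.cong[OF refl])
        fix i assume "i \<in> {..<N}"
        then show "(LBINT s:{t i..t (Suc i)}. Y s \<omega>) = w i * (\<integral>u. Y u \<omega> \<partial>U i)"
          using t(3)[of i] by (simp add: U_def w_def integral_uniform_Icc)
      qed
      finally show "process_integral X \<omega> = (\<Sum>i<N. w i * (\<integral>u. Y u \<omega> \<partial>U i))" .
    qed
  qed
  \<comment> \<open>Path and nodes are separate arguments, so that the joint law can be applied;
    along the actual nodes this is minus the error.\<close>
  define \<Phi> where "\<Phi> \<omega> x = (\<Sum>i<N. w i * (Y (x i) \<omega> - (\<integral>u. Y u \<omega> \<partial>U i)))" for \<omega> and x :: "nat \<Rightarrow> real"
  let ?e = "\<lambda>\<omega>. \<lambda>i\<in>{..<N}. \<eta> i \<omega>"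
  let ?err = "\<lambda>\<omega>. process_integral X \<omega> - stratified_quadrature X N t \<eta> \<omega>"
  have \<Phi>m[measurable]: "(\<lambda>(\<omega>, x). \<Phi> \<omega> x) \<in> borel_measurable (W \<Otimes>\<^sub>M PiM {..<N} U)"
  proof -
    have [measurable]: "(\<lambda>\<omega>. \<integral>u. Y u \<omega> \<partial>U i) \<in> borel_measurable W" for i
    proof -
      interpret Ui: prob_space "U i" by (rule psU)
      show ?thesis by measurable
    qed
    have [measurable]: "(\<lambda>(\<omega>, x). Y (x i) \<omega>) \<in> borel_measurable (W \<Otimes>\<^sub>M PiM {..<N} U)" if "i < N" for i
    proof -
      have "(\<lambda>z. snd z i) \<in> measurable (W \<Otimes>\<^sub>M PiM {..<N} U) (U i)"
        using that by (intro measurable_compose[OF measurable_snd] measurable_component_singleton) auto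
      then have [measurable]: "(\<lambda>z. snd z i) \<in> measurable (W \<Otimes>\<^sub>M PiM {..<N} U) borel"
        using measurable_cong_sets[OF refl setsU] by blast
      show ?thesis by (simp add: case_prod_beta)
    qed
    show ?thesis unfolding \<Phi>_def case_prod_beta
      by (intro borel_measurable_sum borel_measurable_times borel_measurable_diff borel_measurable_const)
         (auto simp: case_prod_beta)
  qed
  have U': "U i = uniform_measure lborel {t i..t (Suc i)}" if "i < N" for i using that by (simp add: U_def)
  note joint = joint_law_stratified_nodes[OF P sub N nodes, of U, OF U', folded W_def, simplified]
  have \<eta>01: "\<eta> i \<omega> \<in> {0..1}" if "i < N" "\<omega> \<in> space P" for i \<omega>
    using nodes that measurable_space[of "\<eta> i" P "restrict_space borel {0..1}"]
    unfolding stratified_nodes_def by (auto simp: space_restrict_space)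
  have errAE: "AE \<omega> in P. ?err \<omega> = - \<Phi> \<omega> (?e \<omega>)"
    using paths
  proof (rule AE_mp, intro AE_I2 impI)
    fix \<omega> assume \<omega>: "\<omega> \<in> space P" and pi: "process_integral X \<omega> = (\<Sum>i<N. w i * (\<integral>u. Y u \<omega> \<partial>U i))"
    have "stratified_quadrature X N t \<eta> \<omega> = (\<Sum>i<N. w i * Y (?e \<omega> i) \<omega>)"
      unfolding stratified_quadrature_def using \<eta>01 \<omega>
      by (intro sum.cong) (auto simp: w_def YX)
    then show "?err \<omega> = - \<Phi> \<omega> (?e \<omega>)"
      unfolding pi \<Phi>_def by (simp add: sum_subtractf right_diff_distrib del: restrict_apply)
  qed
  have \<Phi>e[measurable]: "(\<lambda>\<omega>. \<Phi> \<omega> (?e \<omega>)) \<in> borel_measurable P"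
    using measurable_compose[OF joint(2) \<Phi>m] by simp
  \<comment> \<open>\<open>P\<close> need not be complete, so almost sure equality with a measurable
    function is not enough. Measurability of the error itself is required for the final passage from
    the nonnegative integral to the Bochner integral.\<close>
  have errm: "?err \<in> borel_measurable P"
  proof -
    have "(\<lambda>\<omega>. LBINT s. indicator {0..1} s *\<^sub>R Y s \<omega>) \<in> borel_measurable W"
      by measurable
    then have "(\<lambda>\<omega>. LBINT s. indicator {0..1} s *\<^sub>R Y s \<omega>) \<in> borel_measurable F"
      using measurable_cong_sets[OF setsW refl] by blast
    then have "(\<lambda>\<omega>. LBINT s. indicator {0..1} s *\<^sub>R Y s \<omega>) \<in> borel_measurable P"
      by (rule measurable_from_subalg[OF sub])
    moreover have "(LBINT s. indicator {0..1} s *\<^sub>R Y s \<omega>) = process_integral X \<omega>" for \<omega>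
      unfolding process_integral_def set_lebesgue_integral_def
      by (intro Bochner_Integration.integral_cong) (auto simp: indicator_def YX)
    moreover have "(\<lambda>\<omega>. X (\<eta> i \<omega>) \<omega>) \<in> borel_measurable P" if "i < N" for i
    proof -
      have "\<eta> i \<in> borel_measurable P"
        using nodes that measurable_restrict_space2_iff unfolding stratified_nodes_def by blast
      moreover have "(\<lambda>\<omega>. \<omega>) \<in> measurable P W"
        unfolding W_def by (rule measurable_from_subalg[OF sub]) (simp add: measurable_ident_sets sets_restr_to_subalg[OF sub])
      ultimately have "(\<lambda>\<omega>. Y (\<eta> i \<omega>) \<omega>) \<in> borel_measurable P"
        using measurable_compose[OF measurable_Pair Ym, of "\<eta> i" P "\<lambda>\<omega>. \<omega>"] by simp
      then show ?thesis
        by (rule measurable_cong[THEN iffD1, rotated]) (use \<eta>01 that in \<open>auto simp: YX\<close>)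
    qed
    ultimately show ?thesis
      unfolding stratified_quadrature_def by auto
  qed
  have avg: "(\<integral>\<^sup>+r. \<integral>\<^sup>+s. \<integral>\<^sup>+\<omega>. ennreal ((Y r \<omega> - Y s \<omega>)\<^sup>2) \<partial>W \<partial>U i \<partial>U i)
      = ennreal (mean_square_increment P X (t i) (t (Suc i)))" if i: "i < N" for i
  proof -
    have e: "(\<integral>\<^sup>+r. \<integral>\<^sup>+s. \<integral>\<^sup>+\<omega>. ennreal ((Y r \<omega> - Y s \<omega>)\<^sup>2) \<partial>W \<partial>U i \<partial>U i) =
       (\<integral>\<^sup>+r. \<integral>\<^sup>+s. ennreal ((l2norm P (\<lambda>\<omega>. X r \<omega> - X s \<omega>))\<^sup>2) \<partial>U i \<partial>U i)"
      by (rule nn_integral_cong_AE, rule AE_mp[OF AEU], intro AE_I2 impI,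
          rule nn_integral_cong_AE, rule AE_mp[OF AEU], intro AE_I2 impI inner)
    \<comment> \<open>The bound M makes the mean finite, so \<open>enn2real\<close> loses
      nothing.\<close>
    have "\<dots> \<le> (\<integral>\<^sup>+r. \<integral>\<^sup>+s. ennreal M \<partial>U i \<partial>U i)"
      by (intro nn_integral_mono_AE eventually_mono[OF AEU] ennreal_leI incr_le) auto
    also have "\<dots> < \<infinity>"
      using prob_space.emeasure_space_1[OF psU] by simp
    finally show ?thesis
      unfolding mean_square_increment_def U'[OF i, symmetric] e by simp
  qed
  have msi0: "0 \<le> mean_square_increment P X p q" for p q
    by (simp add: mean_square_increment_def)
  have "(\<integral>\<^sup>+\<omega>. ennreal ((?err \<omega>)\<^sup>2) \<partial>P) = (\<integral>\<^sup>+\<omega>. ennreal ((\<Phi> \<omega> (?e \<omega>))\<^sup>2) \<partial>P)"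
    by (intro nn_integral_cong_AE eventually_mono[OF errAE]) auto
  \<comment> \<open>The integrand depends on the outcome and the node vector only through their
    pair, whose law is the product measure; the expectation thus becomes an iterated integral with
    the path fixed inside.\<close>
  also have "\<dots> = (\<integral>\<^sup>+z. ennreal ((\<Phi> (fst z) (snd z))\<^sup>2) \<partial>distr P (W \<Otimes>\<^sub>M PiM {..<N} U) (\<lambda>\<omega>. (\<omega>, ?e \<omega>)))"
    using \<Phi>m by (subst nn_integral_distr[OF joint(2)]) (auto simp: case_prod_beta)
  also have "\<dots> = (\<integral>\<^sup>+\<omega>. \<integral>\<^sup>+x. ennreal ((\<Phi> \<omega> x)\<^sup>2) \<partial>PiM {..<N} U \<partial>W)"
  proof -
    interpret Pi: prob_space "PiM {..<N} U" by (intro prob_space_PiM psU)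
    show ?thesis unfolding joint(1)
      using \<Phi>m by (subst Pi.nn_integral_fst[symmetric]) (auto simp: case_prod_beta)
  qed
  also have "\<dots> = (\<Sum>i<N. ennreal ((w i)\<^sup>2 / 2) * (\<integral>\<^sup>+r. \<integral>\<^sup>+s. \<integral>\<^sup>+\<omega>. ennreal ((Y r \<omega> - Y s \<omega>)\<^sup>2) \<partial>W \<partial>U i \<partial>U i))"
    unfolding \<Phi>_def by (intro stratified_mean_square_error psU setsU psW Ym bd) auto
  also have "\<dots> = (\<Sum>i<N. ennreal ((w i)\<^sup>2 / 2 * mean_square_increment P X (t i) (t (Suc i))))"
    by (intro sum.cong refl) (simp add: avg ennreal_mult'[symmetric] msi0)
  also have "\<dots> = ennreal (\<Sum>i<N. (w i)\<^sup>2 / 2 * mean_square_increment P X (t i) (t (Suc i)))"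
    by (intro sum_ennreal) (simp add: msi0)
  finally have "(\<integral>\<omega>. (?err \<omega>)\<^sup>2 \<partial>P) = (\<Sum>i<N. (w i)\<^sup>2 / 2 * mean_square_increment P X (t i) (t (Suc i)))"
    using errm by (subst integral_eq_nn_integral) (auto simp: msi0 intro!: sum_nonneg enn2real_ennreal)
  then show ?thesis by (simp add: l2norm_square w_def)
qed

subsection \<open>Increments of the process on shrinking cells\<close>

text \<open>Pointwise bounds are integrated against the explicit mean of the power. In the lower
  estimate the constant \<open>K'\<close> excludes an infinite mean, which \<open>enn2real\<close>
  would turn into 0.\<close>

lemma
  fixes p q b K :: real
  assumes pq: "p < q" and b: "0 < b" and K: "0 \<le> K"
  shows mean_square_increment_le:
      "(\<And>s t. s \<in> {p..q} \<Longrightarrow> t \<in> {p..q} \<Longrightarrow> (l2norm P (\<lambda>\<omega>. X s \<omega> - X t \<omega>))\<^sup>2 \<le> K * \<bar>s - t\<bar> powr b) \<Longrightarrow>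
        mean_square_increment P X p q \<le> K * (2 / ((b + 1) * (b + 2))) * (q - p) powr b" (is "PROP ?A \<Longrightarrow> ?B")
    and mean_square_increment_ge:
      "(\<And>s t. s \<in> {p..q} \<Longrightarrow> t \<in> {p..q} \<Longrightarrow> K * \<bar>s - t\<bar> powr b \<le> (l2norm P (\<lambda>\<omega>. X s \<omega> - X t \<omega>))\<^sup>2) \<Longrightarrow>
       (\<And>s t. s \<in> {p..q} \<Longrightarrow> t \<in> {p..q} \<Longrightarrow> (l2norm P (\<lambda>\<omega>. X s \<omega> - X t \<omega>))\<^sup>2 \<le> K' * \<bar>s - t\<bar> powr b) \<Longrightarrow>
        K * (2 / ((b + 1) * (b + 2))) * (q - p) powr b \<le> mean_square_increment P X p q"
proof -
  let ?U = "uniform_measure lborel {p..q}"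
  let ?J = "\<integral>\<^sup>+s. \<integral>\<^sup>+t. ennreal ((l2norm P (\<lambda>\<omega>. X s \<omega> - X t \<omega>))\<^sup>2) \<partial>?U \<partial>?U"
  have val: "(\<integral>\<^sup>+s. \<integral>\<^sup>+t. ennreal (k * \<bar>s - t\<bar> powr b) \<partial>?U \<partial>?U) = ennreal (k * (2 / ((b + 1) * (b + 2))) * (q - p) powr b)"
    if "0 \<le> k" for k
  proof -
    interpret prob_space ?U using pq by (rule prob_space_uniform_Icc)
    have "(\<integral>\<^sup>+s. \<integral>\<^sup>+t. ennreal (k * \<bar>s - t\<bar> powr b) \<partial>?U \<partial>?U) = ennreal k * (\<integral>\<^sup>+s. \<integral>\<^sup>+t. ennreal (\<bar>s - t\<bar> powr b) \<partial>?U \<partial>?U)"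
      using that by (simp add: ennreal_mult' nn_integral_cmult)
    also have "\<dots> = ennreal (k * (2 / ((b + 1) * (b + 2))) * (q - p) powr b)"
      unfolding mean_powr_abs_diff_uniform[OF pq b] using that by (simp add: ennreal_mult'[symmetric] mult.assoc)
    finally show ?thesis .
  qed
  have upper: "?J \<le> ennreal (k * (2 / ((b + 1) * (b + 2))) * (q - p) powr b)"
    if "0 \<le> k" "\<And>s t. s \<in> {p..q} \<Longrightarrow> t \<in> {p..q} \<Longrightarrow> (l2norm P (\<lambda>\<omega>. X s \<omega> - X t \<omega>))\<^sup>2 \<le> k * \<bar>s - t\<bar> powr b" for k
    unfolding val[OF that(1), symmetric]
    by (rule nn_integral_mono_AE, rule AE_mp[OF AE_uniform_Icc], intro AE_I2 impI,
        rule nn_integral_mono_AE, rule AE_mp[OF AE_uniform_Icc], intro AE_I2 impI ennreal_leI that(2))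
  show ?B if "PROP ?A"
    unfolding mean_square_increment_def using b K upper[OF K that] by (intro enn2real_leI) auto
  show "K * (2 / ((b + 1) * (b + 2))) * (q - p) powr b \<le> mean_square_increment P X p q"
    if lo: "\<And>s t. s \<in> {p..q} \<Longrightarrow> t \<in> {p..q} \<Longrightarrow> K * \<bar>s - t\<bar> powr b \<le> (l2norm P (\<lambda>\<omega>. X s \<omega> - X t \<omega>))\<^sup>2"
      and hi: "\<And>s t. s \<in> {p..q} \<Longrightarrow> t \<in> {p..q} \<Longrightarrow> (l2norm P (\<lambda>\<omega>. X s \<omega> - X t \<omega>))\<^sup>2 \<le> K' * \<bar>s - t\<bar> powr b"
  proof -
    have "?J \<le> ennreal (max 0 K' * (2 / ((b + 1) * (b + 2))) * (q - p) powr b)"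
    proof (rule upper)
      fix s t assume "s \<in> {p..q}" "t \<in> {p..q}"
      then show "(l2norm P (\<lambda>\<omega>. X s \<omega> - X t \<omega>))\<^sup>2 \<le> max 0 K' * \<bar>s - t\<bar> powr b"
        using hi[of s t] mult_right_mono[of K' "max 0 K'" "\<bar>s - t\<bar> powr b"] by simp
    qed simp
    then have fin: "?J < \<top>" by (rule le_less_trans) simp
    have "ennreal (K * (2 / ((b + 1) * (b + 2))) * (q - p) powr b) \<le> ?J"
      unfolding val[OF K, symmetric]
      by (rule nn_integral_mono_AE, rule AE_mp[OF AE_uniform_Icc], intro AE_I2 impI,
          rule nn_integral_mono_AE, rule AE_mp[OF AE_uniform_Icc], intro AE_I2 impI ennreal_leI lo)
    from enn2real_mono[OF this fin] show ?thesis
      unfolding mean_square_increment_def using b K by simp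
  qed
qed

text \<open>Local stationarity compares an increment with \<open>c\<close> at one of its own end
  points; continuity of \<open>c\<close> replaces that value by \<open>c t\<close> for all
  increments near t. Each of the two approximations costs half of \<epsilon>.\<close>

lemma CB_class_increment_asymptotics:
  assumes CB: "CB_class P X \<alpha> c V" and t: "t \<in> {0<..1}" and \<epsilon>: "0 < \<epsilon>"
  shows "\<exists>\<delta>>0. \<delta> \<le> t \<and> (\<forall>s\<in>{0<..1}. \<forall>u\<in>{0<..1}. \<bar>s - t\<bar> < \<delta> \<and> \<bar>u - t\<bar> < \<delta> \<longrightarrow>
      \<bar>(l2norm P (\<lambda>\<omega>. X s \<omega> - X u \<omega>))\<^sup>2 - c t * \<bar>s - u\<bar> powr \<alpha>\<bar> \<le> \<epsilon> * \<bar>s - u\<bar> powr \<alpha>)"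
proof -
  have c: "continuous_on {0<..1} c" "\<And>s. s \<in> {0<..1} \<Longrightarrow> 0 < c s"
    using CB by (auto simp: CB_class_def)
  have c0: "0 < c t" using c t by auto
  have "locally_stationary_class P X (t / 2) 1 \<alpha> c"
    using CB t by (auto simp: CB_class_def)
  then have st': "\<forall>\<epsilon>>0. \<exists>\<delta>>0. \<forall>u s. u \<in> {t / 2..1} \<and> u + s \<in> {t / 2..1} \<and> 0 < \<bar>s\<bar> \<and> \<bar>s\<bar> < \<delta> \<longrightarrow>
       \<bar>(l2norm P (\<lambda>\<omega>. X (u + s) \<omega> - X u \<omega>))\<^sup>2 / (c u * \<bar>s\<bar> powr \<alpha>) - 1\<bar> < \<epsilon>"
    unfolding locally_stationary_class_def by (elim conjE)
  \<comment> \<open>With \<open>c u \<le> 2 * c t\<close>, this relative error becomes at most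
    \<open>\<epsilon> / 2\<close> after multiplication by \<open>c u\<close>.\<close>
  have "0 < \<epsilon> / (4 * c t)" using c0 \<epsilon> by simp
  from st'[rule_format, OF this] obtain \<delta>1 where \<delta>1: "0 < \<delta>1" and
    st: "\<forall>u s. u \<in> {t / 2..1} \<and> u + s \<in> {t / 2..1} \<and> 0 < \<bar>s\<bar> \<and> \<bar>s\<bar> < \<delta>1 \<longrightarrow>
       \<bar>(l2norm P (\<lambda>\<omega>. X (u + s) \<omega> - X u \<omega>))\<^sup>2 / (c u * \<bar>s\<bar> powr \<alpha>) - 1\<bar> < \<epsilon> / (4 * c t)"
    by (elim exE conjE)
  \<comment> \<open>The entry \<open>c t\<close> yields \<open>c u \<le> 2 * c t\<close>; the entry
    \<open>\<epsilon> / 2\<close> is the cost of replacing \<open>c u\<close> by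
    \<open>c t\<close>.\<close>
  have "0 < min (\<epsilon> / 2) (c t)" using \<epsilon> c0 by simp
  then obtain \<delta>2 where \<delta>2: "0 < \<delta>2" and cc: "\<And>u. u \<in> {0<..1} \<Longrightarrow> dist u t < \<delta>2 \<Longrightarrow> dist (c u) (c t) < min (\<epsilon> / 2) (c t)"
    using c(1) t unfolding continuous_on_iff by meson
  \<comment> \<open>Two points within \<open>\<delta>1 / 2\<close> of t are within
    \<open>\<delta>1\<close> of each other, and \<open>t / 2\<close> keeps them in [t/2, 1], where
    stationarity is uniform.\<close>
  define \<delta> where "\<delta> = min (\<delta>1 / 2) (min \<delta>2 (t / 2))"
  show ?thesis
  proof (intro exI[of _ \<delta>] conjI ballI impI)
    show "0 < \<delta>" "\<delta> \<le> t" using \<delta>1 \<delta>2 t by (auto simp: \<delta>_def)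
    fix s u assume "s \<in> {0<..1}" "u \<in> {0<..1}" "\<bar>s - t\<bar> < \<delta> \<and> \<bar>u - t\<bar> < \<delta>"
    then have su: "s \<in> {0<..1}" "u \<in> {0<..1}" "\<bar>s - t\<bar> < \<delta>" "\<bar>u - t\<bar> < \<delta>" by auto
    define E where "E = (l2norm P (\<lambda>\<omega>. X s \<omega> - X u \<omega>))\<^sup>2"
    show "\<bar>(l2norm P (\<lambda>\<omega>. X s \<omega> - X u \<omega>))\<^sup>2 - c t * \<bar>s - u\<bar> powr \<alpha>\<bar> \<le> \<epsilon> * \<bar>s - u\<bar> powr \<alpha>"
    proof (cases "s = u")
      case True
      then show ?thesis by (simp add: l2norm_def)
    next
      case False
      define y where "y = \<bar>s - u\<bar> powr \<alpha>"
      have y: "0 < y" using False by (simp add: y_def)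
      have \<delta>: "\<delta> \<le> \<delta>1 / 2" "\<delta> \<le> \<delta>2" "\<delta> \<le> t / 2" by (auto simp: \<delta>_def)
      have cu: "0 < c u" "\<bar>c u - c t\<bar> \<le> \<epsilon> / 2" "c u \<le> 2 * c t"
      proof -
        have "dist u t < \<delta>2" using su(4) \<delta>(2) unfolding dist_real_def by linarith
        then have "\<bar>c u - c t\<bar> < min (\<epsilon> / 2) (c t)"
          using cc[OF su(2)] unfolding dist_real_def by blast
        then show "\<bar>c u - c t\<bar> \<le> \<epsilon> / 2" "c u \<le> 2 * c t" by linarith+
      qed (rule c(2)[OF su(2)])
      have "\<bar>E / (c u * y) - 1\<bar> < \<epsilon> / (4 * c t)"
        unfolding E_def y_def
      proof (rule st[rule_format, of u "s - u", simplified])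
        have "\<bar>s - u\<bar> < \<delta>1" using su \<delta>(1) by linarith
        moreover have "t / 2 \<le> u" "t / 2 \<le> s" using su \<delta>(3) by linarith+
        ultimately show "t \<le> u * 2 \<and> u \<le> 1 \<and> t \<le> s * 2 \<and> s \<le> 1 \<and> s \<noteq> u \<and> \<bar>s - u\<bar> < \<delta>1"
          using su False by auto
      qed
      moreover have "E - c u * y = (E / (c u * y) - 1) * (c u * y)"
        using cu y by (simp add: field_simps)
      ultimately have "\<bar>E - c u * y\<bar> \<le> \<epsilon> / (4 * c t) * (c u * y)"
        using cu y by (simp only: abs_mult) (simp add: mult_right_mono del: times_divide_eq_left)
      also have "\<dots> \<le> \<epsilon> / (4 * c t) * (2 * c t * y)"
        using cu y \<epsilon> c0 by (intro mult_left_mono mult_right_mono) auto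
      also have "\<dots> = \<epsilon> / 2 * y" using c0 by (simp add: field_simps)
      finally have "\<bar>E - c u * y\<bar> \<le> \<epsilon> / 2 * y" .
      moreover have "\<bar>c u * y - c t * y\<bar> \<le> \<epsilon> / 2 * y"
        using cu y by (simp add: left_diff_distrib[symmetric] abs_mult mult_right_mono)
      ultimately have "\<bar>E - c t * y\<bar> \<le> \<epsilon> * y" by (simp add: abs_real_def split: if_splits)
      then show ?thesis by (simp add: E_def y_def)
    qed
  qed
qed

text \<open>A squeeze: eventually the whole cell lies so close to t that \<open>c\<close> may be
  frozen at t up to \<epsilon>, and the mean of the remaining power is explicit.\<close>

lemma mean_square_increment_asymptotics:
  assumes CB: "CB_class P X \<alpha> c V" and t: "t \<in> {0<..1}" and \<alpha>: "0 < \<alpha>"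
    and pq: "\<forall>\<^sub>F N in sequentially. p N < q N \<and> q N \<le> 1"
    and lim: "p \<longlonglongrightarrow> t" "q \<longlonglongrightarrow> t"
  shows "(\<lambda>N. mean_square_increment P X (p N) (q N) / (q N - p N) powr \<alpha>) \<longlonglongrightarrow> c t * (2 / ((\<alpha> + 1) * (\<alpha> + 2)))"
proof (rule tendstoI)
  fix e :: real assume e: "0 < e"
  define \<kappa> where "\<kappa> = 2 / ((\<alpha> + 1) * (\<alpha> + 2))"
  have \<kappa>: "0 < \<kappa>" using \<alpha> by (simp add: \<kappa>_def)
  have c0: "0 < c t" using CB t by (auto simp: CB_class_def)
  \<comment> \<open>The entry \<open>c t\<close> keeps \<open>c t - \<epsilon>\<close> nonnegative,
    as the lower estimate requires; the other makes the total deviation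
    \<open>\<epsilon> * \<kappa>\<close> smaller than e.\<close>
  define \<epsilon> where "\<epsilon> = min (c t) (e / (2 * \<kappa>))"
  have \<epsilon>: "0 < \<epsilon>" "\<epsilon> \<le> c t" "\<epsilon> * \<kappa> < e"
  proof -
    have "\<epsilon> * \<kappa> \<le> e / (2 * \<kappa>) * \<kappa>" using \<kappa> by (intro mult_right_mono) (auto simp: \<epsilon>_def)
    also have "\<dots> = e / 2" using \<kappa> by simp
    finally show "\<epsilon> * \<kappa> < e" using e by simp
  qed (use c0 e \<kappa> in \<open>auto simp: \<epsilon>_def\<close>)
  obtain \<delta> where \<delta>: "0 < \<delta>" "\<delta> \<le> t" and
    as: "\<And>s u. s \<in> {0<..1} \<Longrightarrow> u \<in> {0<..1} \<Longrightarrow> \<bar>s - t\<bar> < \<delta> \<Longrightarrow> \<bar>u - t\<bar> < \<delta> \<Longrightarrow>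
      \<bar>(l2norm P (\<lambda>\<omega>. X s \<omega> - X u \<omega>))\<^sup>2 - c t * \<bar>s - u\<bar> powr \<alpha>\<bar> \<le> \<epsilon> * \<bar>s - u\<bar> powr \<alpha>"
    using CB_class_increment_asymptotics[OF CB t \<epsilon>(1)] by (elim exE conjE) blast
  have "\<forall>\<^sub>F N in sequentially. dist (p N) t < \<delta>" "\<forall>\<^sub>F N in sequentially. dist (q N) t < \<delta>"
    using tendstoD[OF lim(1) \<delta>(1)] tendstoD[OF lim(2) \<delta>(1)] by auto
  with pq show "\<forall>\<^sub>F N in sequentially. dist (mean_square_increment P X (p N) (q N) / (q N - p N) powr \<alpha>) (c t * (2 / ((\<alpha> + 1) * (\<alpha> + 2)))) < e"
  proof eventually_elim
    case (elim N)
    let ?m = "mean_square_increment P X (p N) (q N)" and ?y = "(q N - p N) powr \<alpha>"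
    have y: "0 < ?y" using elim by simp
    have A: "\<bar>(l2norm P (\<lambda>\<omega>. X s \<omega> - X u \<omega>))\<^sup>2 - c t * \<bar>s - u\<bar> powr \<alpha>\<bar> \<le> \<epsilon> * \<bar>s - u\<bar> powr \<alpha>"
      if "s \<in> {p N..q N}" "u \<in> {p N..q N}" for s u
    proof -
      have "p N - t > - \<delta>" "q N - t < \<delta>" using elim unfolding dist_real_def by linarith+
      then have "0 < s" "\<bar>s - t\<bar> < \<delta>" "0 < u" "\<bar>u - t\<bar> < \<delta>" "s \<le> 1" "u \<le> 1"
        using elim(1) that \<delta>(2) unfolding atLeastAtMost_iff by linarith+
      then show ?thesis by (intro as) auto
    qed
    have up: "(l2norm P (\<lambda>\<omega>. X s \<omega> - X u \<omega>))\<^sup>2 \<le> (c t + \<epsilon>) * \<bar>s - u\<bar> powr \<alpha>"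
      and lo: "(c t - \<epsilon>) * \<bar>s - u\<bar> powr \<alpha> \<le> (l2norm P (\<lambda>\<omega>. X s \<omega> - X u \<omega>))\<^sup>2"
      if "s \<in> {p N..q N}" "u \<in> {p N..q N}" for s u
      using A[OF that] by (simp_all add: abs_le_iff algebra_simps)
    have "?m \<le> (c t + \<epsilon>) * \<kappa> * ?y"
      unfolding \<kappa>_def using c0 \<epsilon> elim \<alpha> up by (intro mean_square_increment_le) auto
    moreover have "(c t - \<epsilon>) * \<kappa> * ?y \<le> ?m"
      unfolding \<kappa>_def using c0 \<epsilon> elim \<alpha> up lo by (intro mean_square_increment_ge[where K' = "c t + \<epsilon>"]) auto
    ultimately have "?m / ?y \<le> (c t + \<epsilon>) * \<kappa>" "(c t - \<epsilon>) * \<kappa> \<le> ?m / ?y"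
      using y by (simp_all add: pos_divide_le_eq pos_le_divide_eq)
    then have "\<bar>?m / ?y - c t * \<kappa>\<bar> \<le> \<epsilon> * \<kappa>" by (simp add: abs_le_iff algebra_simps)
    then show ?case using \<epsilon>(3) unfolding dist_real_def \<kappa>_def[symmetric] by linarith
  qed
qed

section \<open>Cells of subdivisions and of the grids\<close>

lemma subdivision_cover:
  fixes t :: "nat \<Rightarrow> real"
  assumes "t 0 < x" "x \<le> t N"
  shows "\<exists>i<N. x \<in> {t i<..t (Suc i)}"
proof -
  \<comment> \<open>The first node at or beyond x is the right end of its half-open cell; it is not
    node 0 because \<open>t 0 < x\<close>.\<close>
  define j where "j = (LEAST j. x \<le> t j)"
  have j: "x \<le> t j" "j \<le> N" unfolding j_def using assms(2) by (auto intro: LeastI Least_le)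
  then obtain i where i: "j = Suc i" using assms(1) by (cases j) auto
  then have "t i < x" using not_less_Least[of i "\<lambda>j. x \<le> t j"] by (force simp: j_def)
  then show ?thesis using i j by (intro exI[of _ i]) auto
qed

lemma subdivision_unique:
  fixes t :: "nat \<Rightarrow> real"
  assumes "\<And>i. i < N \<Longrightarrow> t i < t (Suc i)" "i < N" "j < N" "x \<in> {t i<..t (Suc i)}" "x \<in> {t j<..t (Suc j)}"
  shows "i = j"
proof (rule linorder_cases[of i j])
  assume "i < j"
  then show ?thesis using subdivision_mono[of N t "Suc i" j] assms by auto
next
  assume "j < i"
  then show ?thesis using subdivision_mono[of N t "Suc j" i] assms by auto
qed

text \<open>Each cell has mass 1/N under \<open>h\<close>. A cell containing t and reaching \<rho>
  away from it would contain a fixed interval beside t, whose mass is positive and independent of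
  N.\<close>

lemma qRS_grid_shrinks:
  assumes h: "qRS_density h" and T: "\<And>N. 1 \<le> N \<Longrightarrow> qRS_grid h N (T N)" and t: "t \<in> {0<..1}" and \<rho>: "0 < \<rho>"
  shows "\<forall>\<^sub>F N in sequentially. \<forall>i<N. t \<in> {T N i<..T N (Suc i)} \<longrightarrow> t - \<rho> < T N i \<and> T N (Suc i) < t + \<rho>"
proof -
  let ?H = "cdf_of h"
  define a b where "a = max (t / 2) (t - \<rho>)" and "b = min 1 (t + \<rho>)"
  have ab: "0 < a" "a < t" "t \<le> b" "b \<le> 1" "t < 1 \<Longrightarrow> t < b" using t \<rho> by (auto simp: a_def b_def)
  have "?H a < ?H t" using ab t by (intro cdf_of_less[OF h]) auto
  \<comment> \<open>For t = 1 there is no room on the right and the entry 1 is a dummy: no node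
    exceeds 1.\<close>
  define d where "d = min (?H t - ?H a) (if t < 1 then ?H b - ?H t else 1)"
  have d: "0 < d"
    using \<open>?H a < ?H t\<close> cdf_of_less[OF h, of t b] ab t by (auto simp: d_def)
  have "\<forall>\<^sub>F N in sequentially. 1 / real N < d"
    using order_tendstoD(2)[OF lim_1_over_n d] by (simp add: inverse_eq_divide)
  with eventually_ge_at_top[of 1] show ?thesis
  proof eventually_elim
    case (elim N)
    have g: "T N 0 = 0" "T N N = 1" "\<And>i. i < N \<Longrightarrow> T N i < T N (Suc i)"
       "\<And>i. i \<le> N \<Longrightarrow> ?H (T N i) = real i / real N"
      using T[OF elim(1)] by (auto simp: qRS_grid_def)
    show ?case
    proof (intro allI impI)
      fix i assume i: "i < N" and ti: "t \<in> {T N i<..T N (Suc i)}"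
      have r: "0 \<le> T N i" "T N (Suc i) \<le> 1"
        using subdivision_mono[of N "T N" 0 i] subdivision_mono[of N "T N" "Suc i" N] g i by auto
      have HS: "?H (T N (Suc i)) = ?H (T N i) + 1 / N" using g(4)[of i] g(4)[of "Suc i"] i by (simp add: add_divide_distrib)
      have "a < T N i"
      proof (rule ccontr)
        assume "\<not> a < T N i"
        then have "?H (T N i) \<le> ?H a" using r ab t by (intro cdf_of_le[OF h]) auto
        moreover have "?H t \<le> ?H (T N (Suc i))" using r ti t by (intro cdf_of_le[OF h]) auto
        ultimately show False using HS elim(2) by (auto simp: d_def)
      qed
      moreover have "T N (Suc i) < t + \<rho>"
      proof (rule ccontr)
        assume n: "\<not> T N (Suc i) < t + \<rho>"
        then have "t < 1" "b \<le> T N (Suc i)" using r \<rho> by (auto simp: b_def)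
        then have "?H b \<le> ?H (T N (Suc i))" using r ab t by (intro cdf_of_le[OF h]) auto
        moreover have "?H (T N i) \<le> ?H t" using r ti t by (intro cdf_of_le[OF h]) auto
        ultimately show False using HS elim(2) \<open>t < 1\<close> by (auto simp: d_def)
      qed
      ultimately show "t - \<rho> < T N i \<and> T N (Suc i) < t + \<rho>" by (auto simp: a_def)
    qed
  qed
qed

text \<open>The left side is the scaled error of the cell divided by its length, the height of a
  step function. The mean value theorem gives \<open>n * (q - p) \<le> g\<close>, and the local
  Hoelder class bounds the mean increment by a multiple of
  \<open>v * (q - p) powr \<alpha>\<close>.\<close>

lemma cell_contribution_le:
  assumes h: "qRS_density h" and CB: "CB_class P X \<alpha> c V" and \<alpha>: "0 < \<alpha>"
    and pq: "0 < p" "p < q" "q \<le> 1" and n: "0 < n" "cdf_of h q - cdf_of h p = 1 / n"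
    and V: "\<And>x. x \<in> {p..q} \<Longrightarrow> V x \<le> v" and g: "\<And>x. x \<in> {p..q} \<Longrightarrow> 1 / h x \<le> g"
  shows "n powr (1 + \<alpha>) * (q - p) * (mean_square_increment P X p q / 2) \<le>
    1 / ((\<alpha> + 1) * (\<alpha> + 2)) * (v * g powr (1 + \<alpha>))"
proof -
  obtain \<xi> where \<xi>: "\<xi> \<in> {p<..<q}" "cdf_of h q - cdf_of h p = h \<xi> * (q - p)"
    using cdf_of_mean_value[OF h pq] by auto
  have h\<xi>: "0 < h \<xi>" using qRS_densityD(2)[OF h] \<xi> pq by auto
  have "n * (q - p) = 1 / h \<xi>" using n \<xi> h\<xi> by (simp add: field_simps)
  then have ng: "n * (q - p) \<le> g" using g[of \<xi>] \<xi> by auto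
  have "0 < V p" using CB pq by (auto simp: CB_class_def)
  then have v: "0 \<le> v" using V[of p] pq by auto
  have m: "mean_square_increment P X p q \<le> v * (2 / ((\<alpha> + 1) * (\<alpha> + 2))) * (q - p) powr \<alpha>"
  proof (rule mean_square_increment_le[OF pq(2) \<alpha> v])
    fix s t assume st: "s \<in> {p..q}" "t \<in> {p..q}"
    have "local_holder_class P X p q \<alpha> V" using CB pq by (auto simp: CB_class_def)
    then obtain u where u: "u \<in> {0..1}" and
      le: "(l2norm P (\<lambda>\<omega>. X (t + (s - t)) \<omega> - X t \<omega>))\<^sup>2 \<le> V (t + (s - t) * u) * \<bar>s - t\<bar> powr \<alpha>"
      using st unfolding local_holder_class_def by (metis add.commute diff_add_cancel)
    \<comment> \<open>The intermediate point is a convex combination of s and t, hence lies in the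
      cell, where v bounds \<open>V\<close>.\<close>
    have "t + (s - t) * u = (1 - u) * t + u * s" by (simp add: algebra_simps)
    moreover have "(1 - u) * t + u * s \<in> {p..q}"
      using convexD_alt[of "{p..q}" t s u] st u by simp
    ultimately have "V (t + (s - t) * u) \<le> v" using V by auto
    then have "V (t + (s - t) * u) * \<bar>s - t\<bar> powr \<alpha> \<le> v * \<bar>s - t\<bar> powr \<alpha>"
      by (intro mult_right_mono) auto
    with le show "(l2norm P (\<lambda>\<omega>. X s \<omega> - X t \<omega>))\<^sup>2 \<le> v * \<bar>s - t\<bar> powr \<alpha>" by simp
  qed
  have "n powr (1 + \<alpha>) * (q - p) * (mean_square_increment P X p q / 2)
      \<le> n powr (1 + \<alpha>) * (q - p) * (v * (2 / ((\<alpha> + 1) * (\<alpha> + 2))) * (q - p) powr \<alpha> / 2)"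
    using m pq by (intro mult_left_mono divide_right_mono) auto
  also have "\<dots> = 1 / ((\<alpha> + 1) * (\<alpha> + 2)) * (v * (n powr (1 + \<alpha>) * ((q - p) * (q - p) powr \<alpha>)))"
    by simp
  also have "(q - p) * (q - p) powr \<alpha> = (q - p) powr (1 + \<alpha>)"
    using pq by (simp add: powr_add)
  also have "n powr (1 + \<alpha>) * (q - p) powr (1 + \<alpha>) = (n * (q - p)) powr (1 + \<alpha>)"
    using n pq by (simp add: powr_mult)
  also have "1 / ((\<alpha> + 1) * (\<alpha> + 2)) * (v * (n * (q - p)) powr (1 + \<alpha>)) \<le> 1 / ((\<alpha> + 1) * (\<alpha> + 2)) * (v * g powr (1 + \<alpha>))"
    using ng n pq v \<alpha> by (intro mult_left_mono powr_mono2) auto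
  finally show ?thesis .
qed

text \<open>The cells around x shrink to x, so N times their length tends to \<open>1 / h x\<close>
  by continuity, and the normalised mean increment tends to its stationary value. Their left ends
  are eventually positive, so they are not first cells.\<close>

lemma cell_contribution_tendsto:
  assumes h: "qRS_density h" and CB: "CB_class P X \<alpha> c V" and \<alpha>: "0 < \<alpha>"
    and T: "\<And>N. 1 \<le> N \<Longrightarrow> qRS_grid h N (T N)" and x: "x \<in> {0<..1}"
    and i: "\<And>N. 1 \<le> N \<Longrightarrow> i N < N \<and> x \<in> {T N (i N)<..T N (Suc (i N))}"
  shows "(\<lambda>N. real N powr (1 + \<alpha>) * (T N (Suc (i N)) - T N (i N)) *
      (mean_square_increment P X (T N (i N)) (T N (Suc (i N))) / 2))
    \<longlonglongrightarrow> 1 / ((1 + \<alpha>) * (2 + \<alpha>)) * (c x * h x powr (- (1 + \<alpha>)))"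
    and "\<forall>\<^sub>F N in sequentially. 1 \<le> i N"
proof -
  define p q where "p N = T N (i N)" and "q N = T N (Suc (i N))" for N
  have near: "\<forall>\<^sub>F N in sequentially. x - \<rho> < p N \<and> p N < x \<and> x \<le> q N \<and> q N < x + \<rho>" if "0 < \<rho>" for \<rho>
  proof -
    have "\<forall>\<^sub>F N in sequentially. \<forall>i<N. x \<in> {T N i<..T N (Suc i)} \<longrightarrow> x - \<rho> < T N i \<and> T N (Suc i) < x + \<rho>"
      by (rule qRS_grid_shrinks[OF h]) (use T x that in auto)
    then show ?thesis using eventually_ge_at_top[of 1]
      by eventually_elim (use i in \<open>auto simp: p_def q_def\<close>)
  qed
  have plim: "p \<longlonglongrightarrow> x"
    by (rule tendstoI, rule eventually_mono[OF near]) (auto simp: dist_real_def)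
  have qlim: "q \<longlonglongrightarrow> x"
    by (rule tendstoI, rule eventually_mono[OF near]) (auto simp: dist_real_def)
  have p0: "\<forall>\<^sub>F N in sequentially. 0 < p N"
    using near[of x] x by (auto elim: eventually_mono)
  have good: "\<forall>\<^sub>F N in sequentially. 0 < real N \<and> 0 < p N \<and> p N < q N \<and> q N \<le> 1 \<and> cdf_of h (q N) - cdf_of h (p N) = 1 / real N"
    using p0 eventually_ge_at_top[of 1]
  proof eventually_elim
    case (elim N)
    have g: "T N N = 1" "\<And>i. i < N \<Longrightarrow> T N i < T N (Suc i)"
       "\<And>i. i \<le> N \<Longrightarrow> cdf_of h (T N i) = real i / real N"
      using T[OF elim(2)] by (auto simp: qRS_grid_def)
    have iN: "i N < N" using i[OF elim(2)] by simp
    show ?case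
      using elim g(2)[OF iN] subdivision_mono[of N "T N" "Suc (i N)" N] g(1,2) iN g(3)[of "i N"] g(3)[of "Suc (i N)"]
      by (simp add: p_def q_def diff_divide_distrib[symmetric])
  qed
  show "\<forall>\<^sub>F N in sequentially. 1 \<le> i N"
    using p0 eventually_ge_at_top[of 1]
  proof eventually_elim
    case (elim N)
    then show ?case using T[OF elim(2)] by (cases "i N") (auto simp: p_def qRS_grid_def)
  qed
  \<comment> \<open>The mean value points are chosen for all N at once, constrained only where the
    left end of the cell is positive.\<close>
  have "\<exists>\<xi>. \<forall>N. 0 < p N \<and> p N < q N \<and> q N \<le> 1 \<longrightarrow>
      \<xi> N \<in> {p N<..<q N} \<and> cdf_of h (q N) - cdf_of h (p N) = h (\<xi> N) * (q N - p N)"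
    using cdf_of_mean_value[OF h] by (intro choice) metis
  then obtain \<xi> where \<xi>: "\<And>N. 0 < p N \<Longrightarrow> p N < q N \<Longrightarrow> q N \<le> 1 \<Longrightarrow>
      \<xi> N \<in> {p N<..<q N} \<and> cdf_of h (q N) - cdf_of h (p N) = h (\<xi> N) * (q N - p N)" by blast
  have \<xi>lim: "\<xi> \<longlonglongrightarrow> x"
  proof (rule tendsto_sandwich[OF _ _ plim qlim])
    show "\<forall>\<^sub>F N in sequentially. p N \<le> \<xi> N" "\<forall>\<^sub>F N in sequentially. \<xi> N \<le> q N"
      using good \<xi> by (auto elim!: eventually_mono intro: less_imp_le)
  qed
  have hx: "0 < h x" using qRS_densityD(2)[OF h x] .
  have "(\<lambda>N. h (\<xi> N)) \<longlonglongrightarrow> h x"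
  proof (rule continuous_on_tendsto_compose[OF qRS_densityD(1)[OF h] \<xi>lim x])
    show "\<forall>\<^sub>F N in sequentially. \<xi> N \<in> {0<..1}"
      using good
    proof eventually_elim
      case (elim N)
      then show ?case using \<xi>[of N] by auto
    qed
  qed
  then have "(\<lambda>N. (1 / h (\<xi> N)) powr (1 + \<alpha>)) \<longlonglongrightarrow> (1 / h x) powr (1 + \<alpha>)"
    using hx by (intro tendsto_intros) auto
  moreover have "(\<lambda>N. mean_square_increment P X (p N) (q N) / (q N - p N) powr \<alpha>) \<longlonglongrightarrow> c x * (2 / ((\<alpha> + 1) * (\<alpha> + 2)))"
    using good by (intro mean_square_increment_asymptotics[OF CB x \<alpha> _ plim qlim]) (auto elim: eventually_mono)
  ultimately have "(\<lambda>N. (1 / h (\<xi> N)) powr (1 + \<alpha>) * (mean_square_increment P X (p N) (q N) / (q N - p N) powr \<alpha> / 2))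
      \<longlonglongrightarrow> (1 / h x) powr (1 + \<alpha>) * (c x * (2 / ((\<alpha> + 1) * (\<alpha> + 2))) / 2)"
    by (rule tendsto_mult[OF _ tendsto_divide[OF _ tendsto_const]]) auto
  also have "(1 / h x) powr (1 + \<alpha>) * (c x * (2 / ((\<alpha> + 1) * (\<alpha> + 2))) / 2) = 1 / ((1 + \<alpha>) * (2 + \<alpha>)) * (c x * h x powr (- (1 + \<alpha>)))"
    unfolding powr_minus_divide using hx by (simp add: powr_divide add.commute)
  finally show "(\<lambda>N. real N powr (1 + \<alpha>) * (T N (Suc (i N)) - T N (i N)) *
      (mean_square_increment P X (T N (i N)) (T N (Suc (i N))) / 2))
    \<longlonglongrightarrow> 1 / ((1 + \<alpha>) * (2 + \<alpha>)) * (c x * h x powr (- (1 + \<alpha>)))"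
  \<comment> \<open>Eventually \<open>1 / h (\<xi> N)\<close> is N times the cell length. Its power
    1 + \<alpha> supplies the power of N, one factor of the length, and the power \<alpha> of the
    length that cancels the normalisation.\<close>
  proof (rule Lim_transform_eventually)
    show "\<forall>\<^sub>F N in sequentially. (1 / h (\<xi> N)) powr (1 + \<alpha>) * (mean_square_increment P X (p N) (q N) / (q N - p N) powr \<alpha> / 2) =
      real N powr (1 + \<alpha>) * (T N (Suc (i N)) - T N (i N)) *
      (mean_square_increment P X (T N (i N)) (T N (Suc (i N))) / 2)"
      using good
    proof eventually_elim
      case (elim N)
      then have \<xi>N: "\<xi> N \<in> {p N<..<q N}" "cdf_of h (q N) - cdf_of h (p N) = h (\<xi> N) * (q N - p N)"
        using \<xi>[of N] by auto
      then have "0 < h (\<xi> N)" using qRS_densityD(2)[OF h, of "\<xi> N"] elim by auto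
      then have "1 / h (\<xi> N) = real N * (q N - p N)"
        using \<xi>N elim by (simp add: field_simps)
      then have "(1 / h (\<xi> N)) powr (1 + \<alpha>) = real N powr (1 + \<alpha>) * ((q N - p N) * (q N - p N) powr \<alpha>)"
        using elim by (simp add: powr_mult powr_add)
      then show ?case unfolding p_def[symmetric] q_def[symmetric] using elim by simp
    qed
  qed
qed

text \<open>As k \<ge> 1, the end points have ratio (k + 1) / k \<le> 2, so any two points of the
  cell have ratio between 1/2 and 2. The first cell, k = 0, escapes this argument.\<close>

lemma shifting_condition_cell:
  assumes "shifting_condition f (1 / 2) 2"
  obtains C a where "0 < C" "0 < a" "\<And>(n::real) k s v. 0 < n \<Longrightarrow> 1 \<le> k \<Longrightarrow> (k + 1) / n \<le> a \<Longrightarrow>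
    s \<in> {k / n..(k + 1) / n} \<Longrightarrow> v \<in> {k / n..(k + 1) / n} \<Longrightarrow> f s \<le> C * f v"
proof -
  obtain C a where C: "0 < C" "0 < a" and
    sh: "\<forall>s\<in>{0<..a}. \<forall>v\<in>{0<..a}. 1 / 2 \<le> s / v \<and> s / v \<le> 2 \<longrightarrow> f s \<le> C * f v"
    using assms unfolding shifting_condition_def by blast
  show thesis
  proof (rule that[OF C])
    fix n k s v :: real
    assume n: "0 < n" "1 \<le> k" "(k + 1) / n \<le> a" and s: "s \<in> {k / n..(k + 1) / n}" and v: "v \<in> {k / n..(k + 1) / n}"
    have k0: "0 < k / n" using n by simp
    have "(k + 1) / n \<le> 2 * (k / n)" using n by (simp add: divide_right_mono)
    then have "s \<le> 2 * v" "v \<le> 2 * s" "0 < s" "0 < v" "s \<le> a" "v \<le> a"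
      using s v k0 n(3) unfolding atLeastAtMost_iff by linarith+
    then show "f s \<le> C * f v" by (intro sh[rule_format]) (auto simp: field_simps)
  qed
qed

text \<open>The first cell is [0, G(1/N)], where the global Hoelder class bounds the error by a
  constant times G(1/N)^(2+\<beta>). Multiplied by N^\<gamma>, this is the power 2 + \<beta> of the
  ratio in the little-o assumption. The case needed is \<gamma> = 1 + \<alpha>.\<close>

lemma first_cell_tendsto_0:
  assumes h: "qRS_density h" and H: "holder_class P X \<beta> M" and \<beta>: "0 < \<beta>" and M: "0 \<le> M"
    and T: "\<And>N. 1 \<le> N \<Longrightarrow> qRS_grid h N (T N)"
    and small: "quantile_of h \<in> o[at_right 0](\<lambda>s. s powr (\<gamma> / (2 + \<beta>)))"
  shows "(\<lambda>N. real N powr \<gamma> * ((T N 1 - T N 0)\<^sup>2 / 2 * mean_square_increment P X (T N 0) (T N 1))) \<longlonglongrightarrow> 0"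
proof -
  let ?\<kappa> = "2 / ((\<beta> + 1) * (\<beta> + 2))"
  have "((\<lambda>s. quantile_of h s / s powr (\<gamma> / (2 + \<beta>))) \<longlongrightarrow> 0) (at_right 0)"
    using small by (rule smalloD_tendsto)
  moreover have "filterlim (\<lambda>N. 1 / real N) (at_right 0) sequentially"
    unfolding filterlim_at using lim_1_over_n
    by (auto simp: eventually_sequentially intro!: exI[of _ 1])
  ultimately have "(\<lambda>N. quantile_of h (1 / real N) / (1 / real N) powr (\<gamma> / (2 + \<beta>))) \<longlonglongrightarrow> 0"
    by (rule filterlim_compose)
  then have "(\<lambda>N. \<bar>quantile_of h (1 / real N) / (1 / real N) powr (\<gamma> / (2 + \<beta>))\<bar> powr (2 + \<beta>)) \<longlonglongrightarrow> 0"
    using \<beta> by (intro tendsto_zero_powrI[where b = "2 + \<beta>"] tendsto_rabs_zero) auto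
  then have lim: "(\<lambda>N. M * ?\<kappa> / 2 * (\<bar>quantile_of h (1 / real N) / (1 / real N) powr (\<gamma> / (2 + \<beta>))\<bar> powr (2 + \<beta>))) \<longlonglongrightarrow> 0"
    by (rule tendsto_mult_right_zero)
  show ?thesis
  proof (rule tendsto_sandwich[OF _ _ tendsto_const lim])
    show "\<forall>\<^sub>F N in sequentially. 0 \<le> real N powr \<gamma> * ((T N 1 - T N 0)\<^sup>2 / 2 * mean_square_increment P X (T N 0) (T N 1))"
      by (simp add: mean_square_increment_def)
    show "\<forall>\<^sub>F N in sequentially. real N powr \<gamma> * ((T N 1 - T N 0)\<^sup>2 / 2 * mean_square_increment P X (T N 0) (T N 1))
        \<le> M * ?\<kappa> / 2 * (\<bar>quantile_of h (1 / real N) / (1 / real N) powr (\<gamma> / (2 + \<beta>))\<bar> powr (2 + \<beta>))"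
      using eventually_ge_at_top[of 1]
    proof eventually_elim
      case (elim N)
      have g: "T N 0 = 0" "T N N = 1" "\<And>i. i < N \<Longrightarrow> T N i < T N (Suc i)" "cdf_of h (T N 1) = 1 / real N"
        using T[OF elim] elim by (auto simp: qRS_grid_def)
      define d where "d = T N 1"
      have d: "0 < d" "d \<le> 1"
        using g(1,2) g(3)[of 0] subdivision_mono[of N "T N" 1 N] g(3) elim by (auto simp: d_def)
      have q: "quantile_of h (1 / real N) = d"
        using quantile_of_cdf_of[OF h, of d] d g(4) by (simp add: d_def)
      have "mean_square_increment P X 0 d \<le> M * ?\<kappa> * (d - 0) powr \<beta>"
        using d by (intro mean_square_increment_le \<beta> M holder_class_increment_le[OF H]) auto
      then have "real N powr \<gamma> * (d\<^sup>2 / 2 * mean_square_increment P X 0 d) \<le> real N powr \<gamma> * (d\<^sup>2 / 2 * (M * ?\<kappa> * d powr \<beta>))"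
        by (intro mult_left_mono) auto
      also have "\<dots> = M * ?\<kappa> / 2 * (real N powr \<gamma> * (d\<^sup>2 * d powr \<beta>))" by simp
      also have "d\<^sup>2 * d powr \<beta> = d powr (2 + \<beta>)" using d by (simp add: powr_add)
      also have "real N powr \<gamma> * d powr (2 + \<beta>) = \<bar>d / (1 / real N) powr (\<gamma> / (2 + \<beta>))\<bar> powr (2 + \<beta>)"
        using d elim \<beta> by (simp add: powr_divide powr_powr powr_mult abs_mult)
      finally show ?case by (simp only: q d_def[symmetric] g(1) diff_zero)
    qed
  qed
qed

subsection \<open>The asymptotic error\<close>

theorem theorem4:
  fixes P F :: "'a measure" and X :: "real \<Rightarrow> 'a \<Rightarrow> real"
    and \<alpha> \<beta> M :: real and c V h R r :: "real \<Rightarrow> real"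
    and T :: "nat \<Rightarrow> nat \<Rightarrow> real" and \<eta> :: "nat \<Rightarrow> nat \<Rightarrow> 'a \<Rightarrow> real"
  assumes "0 < \<alpha>" and "\<alpha> < 2" and "0 < \<beta>" and "\<beta> \<le> \<alpha> - 1" and "0 < M"
    and "prob_space P"
    and "second_order_process P F X"
    and "holder_class P X \<beta> M"
    and "CB_class P X \<alpha> c V"
    and "qRS_density h"
    and "\<And>N. 1 \<le> N \<Longrightarrow> qRS_grid h N (T N)"
    and "\<And>N. 1 \<le> N \<Longrightarrow> stratified_nodes P F N (T N) (\<eta> N)"
    and "\<And>s. s \<in> {0<..1} \<Longrightarrow> V (quantile_of h s) \<le> R s"
    and "\<And>s. s \<in> {0<..1} \<Longrightarrow> quantile_density h s \<le> r s"
    and "shifting_condition R (1/2) 2"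
    and "shifting_condition r (1/2) 2"
    and "set_integrable lebesgue {0<..1} (\<lambda>t. R (cdf_of h t) * r (cdf_of h t) powr (1 + \<alpha>))"
    and "quantile_of h \<in> o[at_right 0](\<lambda>s. s powr ((1 + \<alpha>) / (2 + \<beta>)))"
  shows "(\<lambda>N. real N powr (1 + \<alpha>) *
            (l2norm P (\<lambda>\<omega>. process_integral X \<omega> - stratified_quadrature X N (T N) (\<eta> N) \<omega>))\<^sup>2)
         \<longlonglongrightarrow> 1 / ((1 + \<alpha>) * (2 + \<alpha>)) * (LBINT t:{0<..1}. c t * h t powr (- (1 + \<alpha>)))"
proof -
  note \<alpha> = assms(1) and CB = assms(9) and h = assms(10) and T = assms(11) and nodes = assms(12)

  \<comment> \<open>The cells as a step function\<close>
  let ?H = "cdf_of h"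
  define a where "a = 1 / ((\<alpha> + 1) * (\<alpha> + 2))"
  have a: "0 < a" using \<alpha> by (simp add: a_def)
  \<comment> \<open>Half-open cells partition (0, 1], so each point meets exactly one of
    them.\<close>
  define cell where "cell N i = {T N i<..T N (Suc i)}" for N i
  \<comment> \<open>The scaled error of a cell divided by its length, so that integration over the
    cell restores the error.\<close>
  define G where "G N i = real N powr (1 + \<alpha>) * (T N (Suc i) - T N i) * (mean_square_increment P X (T N i) (T N (Suc i)) / 2)" for N i
  \<comment> \<open>The sum starts at 1: the first cell is estimated separately.\<close>
  define f where "f N x = (\<Sum>i\<in>{1..<N}. indicator (cell N i) x * G N i)" for N x
  define L where "L x = indicator {0<..1} x * (a * (c x * h x powr (- (1 + \<alpha>))))" for x
  have g: "T N 0 = 0" "T N N = 1" "\<And>i. i < N \<Longrightarrow> T N i < T N (Suc i)" "\<And>i. i \<le> N \<Longrightarrow> ?H (T N i) = real i / real N"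
    if "1 \<le> N" for N
    using T[OF that] by (auto simp: qRS_grid_def)
  have Tle: "T N i \<le> T N j" if "1 \<le> N" "i \<le> j" "j \<le> N" for N i j
    using subdivision_mono[of N "T N"] g(3) that by blast
  have f_cell: "f N x = (if 1 \<le> i then G N i else 0)" if "1 \<le> N" "i < N" "x \<in> cell N i" for N i x
  proof -
    have "indicator (cell N j) x * G N j = (if j = i then G N i else 0)" if "j \<in> {1..<N}" for j
    proof (cases "j = i")
      case False
      have "i = j" if "x \<in> cell N j"
        by (rule subdivision_unique[of N "T N" i j x])
           (use \<open>1 \<le> N\<close> \<open>i < N\<close> \<open>x \<in> cell N i\<close> \<open>j \<in> {1..<N}\<close> that g(3) in \<open>auto simp: cell_def\<close>)
      then have "x \<notin> cell N j" using False by blast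
      then show ?thesis using False by simp
    qed (use \<open>x \<in> cell N i\<close> in simp)
    then have "f N x = (\<Sum>j\<in>{1..<N}. if j = i then G N i else 0)"
      unfolding f_def by (intro sum.cong) auto
    then show ?thesis using \<open>i < N\<close> by simp
  qed
  have f_out: "f N x = 0" if "x \<notin> {0<..1}" for N x
    unfolding f_def
  proof (intro sum.neutral ballI)
    fix i assume i: "i \<in> {1..<N}"
    then have "0 \<le> T N i" "T N (Suc i) \<le> 1" using Tle[of N 0 i] Tle[of N "Suc i" N] g[of N] by auto
    then show "indicator (cell N i) x * G N i = 0" using that by (auto simp: cell_def indicator_def)
  qed
  have G0: "0 \<le> G N i" if "i < N" for N i
    using g(3)[of N i] that by (simp add: G_def mean_square_increment_def)
  have f0: "0 \<le> f N x" for N x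
    unfolding f_def using G0 by (intro sum_nonneg) auto

  \<comment> \<open>Exact decomposition of the scaled error\<close>
  have fm: "f N \<in> borel_measurable borel" for N
    unfolding f_def[abs_def] cell_def by measurable
  have err: "real N powr (1 + \<alpha>) * (l2norm P (\<lambda>\<omega>. process_integral X \<omega> - stratified_quadrature X N (T N) (\<eta> N) \<omega>))\<^sup>2
      = real N powr (1 + \<alpha>) * ((T N 1 - T N 0)\<^sup>2 / 2 * mean_square_increment P X (T N 0) (T N 1)) + (\<integral>x. f N x \<partial>lebesgue)"
    if N: "1 \<le> N" for N
  proof -
    let ?t = "\<lambda>i. (T N (Suc i) - T N i)\<^sup>2 / 2 * mean_square_increment P X (T N i) (T N (Suc i))"
    \<comment> \<open>The Lebesgue measure is used because \<open>R\<close> and \<open>r\<close>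
      need not be Borel: the dominating function is integrable with respect to the
      completion.\<close>
    have "(\<integral>x. f N x \<partial>lebesgue) = (\<integral>x. f N x \<partial>lborel)"
      using fm by (intro integral_completion) simp
    also have "\<dots> = (\<Sum>i\<in>{1..<N}. (\<integral>x. indicator (cell N i) x * G N i \<partial>lborel))"
      unfolding f_def cell_def
      by (intro Bochner_Integration.integral_sum integrable_mult_left integrable_real_indicator)
         (use less_imp_le[OF g(3)[OF N]] in auto)
    also have "\<dots> = (\<Sum>i\<in>{1..<N}. real N powr (1 + \<alpha>) * ?t i)"
    proof (rule sum.cong[OF refl])
      fix i assume i: "i \<in> {1..<N}"
      have "T N i \<le> T N (Suc i)" using g(3)[OF N, of i] i by auto
      then have "(\<integral>x. indicator (cell N i) x * G N i \<partial>lborel) = (T N (Suc i) - T N i) * G N i"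
        by (simp add: cell_def)
      then show "(\<integral>x. indicator (cell N i) x * G N i \<partial>lborel) = real N powr (1 + \<alpha>) * ?t i"
        by (simp add: G_def power2_eq_square)
    qed
    finally have I: "(\<integral>x. f N x \<partial>lebesgue) = (\<Sum>i\<in>{1..<N}. real N powr (1 + \<alpha>) * ?t i)" .
    have "(l2norm P (\<lambda>\<omega>. process_integral X \<omega> - stratified_quadrature X N (T N) (\<eta> N) \<omega>))\<^sup>2 = (\<Sum>i<N. ?t i)"
      using stratified_quadrature_error[OF assms(6,7,8) _ _ _ g(1-3)[OF N] nodes[OF N]] assms(3,5) N by simp
    also have "(\<Sum>i<N. ?t i) = ?t 0 + (\<Sum>i\<in>{1..<N}. ?t i)"
      using N by (simp add: lessThan_atLeast0 sum.atLeast_Suc_lessThan)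
    finally show ?thesis
      unfolding I by (simp add: distrib_left sum_distrib_left)
  qed

  \<comment> \<open>An integrable majorant\<close>
  obtain CR aR where CR: "0 < CR" "0 < aR" and shR: "\<And>(n::real) k s v. 0 < n \<Longrightarrow> 1 \<le> k \<Longrightarrow> (k + 1) / n \<le> aR \<Longrightarrow>
    s \<in> {k / n..(k + 1) / n} \<Longrightarrow> v \<in> {k / n..(k + 1) / n} \<Longrightarrow> R s \<le> CR * R v"
    using shifting_condition_cell[OF assms(15)] by blast
  obtain Cr ar where Cr: "0 < Cr" "0 < ar" and shr: "\<And>(n::real) k s v. 0 < n \<Longrightarrow> 1 \<le> k \<Longrightarrow> (k + 1) / n \<le> ar \<Longrightarrow>
    s \<in> {k / n..(k + 1) / n} \<Longrightarrow> v \<in> {k / n..(k + 1) / n} \<Longrightarrow> r s \<le> Cr * r v"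
    using shifting_condition_cell[OF assms(16)] by blast
  have Rpos: "0 < R s" and rpos: "0 < r s" if "s \<in> {0<..1}" for s
    using assms(15,16) that by (auto simp: shifting_condition_def)
  have H01: "?H x \<in> {0<..1}" if "x \<in> {0<..1}" for x
    using cdf_of_less[OF h, of 0 x] cdf_of_le[OF h, of x 1] cdf_of_0[OF h] g(2)[of 1] g(4)[of 1 1] that by auto
  \<comment> \<open>The bounds in the variable s are transported by s = H(x). As H(x) > 0, the
    special value of the quantile density at 0 is never met.\<close>
  have VR: "V x \<le> R (?H x)" and hr: "1 / h x \<le> r (?H x)" if "x \<in> {0<..1}" for x
    using assms(13)[OF H01[OF that]] assms(14)[OF H01[OF that]] quantile_of_cdf_of[OF h, of x] that H01[OF that]
    by (auto simp: quantile_density_def)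

  define \<epsilon> where "\<epsilon> = min aR ar"
  have \<epsilon>: "0 < \<epsilon>" using CR Cr by (simp add: \<epsilon>_def)
  \<comment> \<open>The number N0 is chosen so that \<open>1 / N0 \<le> \<epsilon> / 2\<close>,
    where \<epsilon> is a range on which both shifting conditions apply.\<close>
  obtain n0 where "2 / \<epsilon> \<le> real n0" using real_arch_simple by blast
  then obtain N0 where N0: "1 \<le> N0" "2 / \<epsilon> \<le> real N0" by (intro that[of "Suc n0"]) auto
  \<comment> \<open>A grid node serves as a point with H(b) = 1/N0, without appeal to surjectivity
    of H.\<close>
  define b where "b = T N0 1"
  have b: "0 < b" "b \<le> 1" "?H b = 1 / real N0"
    using g(1)[OF N0(1)] g(3)[OF N0(1), of 0] g(2)[OF N0(1)] Tle[OF N0(1), of 1 N0] g(4)[OF N0(1), of 1] N0 by (auto simp: b_def)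
  \<comment> \<open>On the compact interval [b, 1], away from the singularity at 0, \<open>V\<close>
    and \<open>1 / h\<close> attain their maxima.\<close>
  have cont: "continuous_on {b..1} V" "continuous_on {b..1} (\<lambda>x. 1 / h x)"
  proof -
    show "continuous_on {b..1} V"
      using CB b by (auto simp: CB_class_def intro: continuous_on_subset)
    show "continuous_on {b..1} (\<lambda>x. 1 / h x)"
    proof (intro continuous_intros ballI continuous_on_subset[OF qRS_densityD(1)[OF h]])
      show "h x \<noteq> 0" if "x \<in> {b..1}" for x using qRS_densityD(2)[OF h, of x] that b by auto
    qed (use b in auto)
  qed
  have ne: "{b..1} \<noteq> {}" using b by simp
  obtain vm where vm: "\<And>x. x \<in> {b..1} \<Longrightarrow> V x \<le> V vm"
    using continuous_attains_sup[OF compact_Icc ne cont(1)] by blast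
  obtain gm where gm: "\<And>x. x \<in> {b..1} \<Longrightarrow> 1 / h x \<le> 1 / h gm"
    using continuous_attains_sup[OF compact_Icc ne cont(2)] by blast
  have "0 < V 1" using CB by (auto simp: CB_class_def)
  then have Vm: "0 \<le> V vm" using vm[of 1] b by auto
  \<comment> \<open>\<open>K\<close> serves the cells near 0 and \<open>K'\<close> those inside
    [b, 1]; the majorant adds the two bounds, so it does not depend on N.\<close>
  define K K' where "K = a * (CR * Cr powr (1 + \<alpha>))" and "K' = a * (V vm * (1 / h gm) powr (1 + \<alpha>))"
  have K: "0 \<le> K" "0 \<le> K'" using a CR Vm by (auto simp: K_def K'_def)
  define w where "w x = indicator {0<..1} x * (K * (R (?H x) * r (?H x) powr (1 + \<alpha>)) + K')" for x

  have bound: "f N x \<le> w x" for N x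
  proof (cases "x \<in> {0<..1} \<and> 1 \<le> N")
    case False
    have "f N x = 0" using f_out[of x N] False by (cases "N = 0") (auto simp: f_def)
    moreover have "0 \<le> w x"
    proof (cases "x \<in> {0<..1}")
      case x: True
      have "0 \<le> K * (R (?H x) * r (?H x) powr (1 + \<alpha>)) + K'"
        by (intro add_nonneg_nonneg mult_nonneg_nonneg K less_imp_le[OF Rpos[OF H01[OF x]]] powr_ge_zero)
      then show ?thesis using x by (simp add: w_def)
    qed (simp add: w_def)
    ultimately show ?thesis by simp
  next
    case True
    then have x: "x \<in> {0<..1}" and N: "1 \<le> N" by auto
    obtain i where i: "i < N" "x \<in> cell N i"
      using subdivision_cover[of "T N" x N] g[OF N] x by (auto simp: cell_def)
    have Rx: "0 < R (?H x)" "0 < r (?H x)" using Rpos rpos H01[OF x] by auto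
    have w0: "0 \<le> K * (R (?H x) * r (?H x) powr (1 + \<alpha>))" using K Rx by simp
    show ?thesis
    proof (cases "1 \<le> i")
      case False
      then show ?thesis using f_cell[OF N i] w0 K x by (simp add: w_def)
    next
      case True
      let ?p = "T N i" and ?q = "T N (Suc i)"
      have "0 < T N 1" using g(1)[OF N] g(3)[OF N, of 0] N by auto
      then have pq: "0 < ?p" "?p < ?q" "?q \<le> 1"
        using Tle[OF N True] i g(3)[OF N i(1)] Tle[OF N, of "Suc i" N] g(2)[OF N] by auto
      have n: "0 < real N" "?H ?q - ?H ?p = 1 / real N"
        using N i g(4)[OF N, of i] g(4)[OF N, of "Suc i"] by (auto simp: diff_divide_distrib[symmetric])
      have Hy: "?H y \<in> {real i / real N..(real i + 1) / real N}" if "y \<in> {?p..?q}" for y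
        using that cdf_of_le[OF h, of ?p y] cdf_of_le[OF h, of y ?q] pq g(4)[OF N, of i] g(4)[OF N, of "Suc i"] i
        by (simp add: add.commute)
      have xpq: "x \<in> {?p..?q}" using i by (auto simp: cell_def)
      have fG: "f N x = G N i" using f_cell[OF N i] True by simp
      show ?thesis
      \<comment> \<open>Near 0 in the scale of H, shifting compares the values of \<open>R\<close>
        and \<open>r\<close> anywhere in the cell with those at H(x). The other cells lie in
        [b, 1].\<close>
      proof (cases "(real i + 1) / real N \<le> \<epsilon>")
        case le: True
        have "V y \<le> CR * R (?H x)" if "y \<in> {?p..?q}" for y
        proof -
          have "V y \<le> R (?H y)" using that pq by (intro VR) auto
          also have "\<dots> \<le> CR * R (?H x)"
            using le n True Hy[OF that] Hy[OF xpq] by (intro shR[of "real N" "real i"]) (auto simp: \<epsilon>_def)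
          finally show ?thesis .
        qed
        moreover have "1 / h y \<le> Cr * r (?H x)" if "y \<in> {?p..?q}" for y
        proof -
          have "1 / h y \<le> r (?H y)" using that pq by (intro hr) auto
          also have "\<dots> \<le> Cr * r (?H x)"
            using le n True Hy[OF that] Hy[OF xpq] by (intro shr[of "real N" "real i"]) (auto simp: \<epsilon>_def)
          finally show ?thesis .
        qed
        ultimately have "G N i \<le> a * (CR * R (?H x) * (Cr * r (?H x)) powr (1 + \<alpha>))"
          unfolding G_def a_def by (intro cell_contribution_le[OF h CB \<alpha> pq n])
        also have "\<dots> = K * (R (?H x) * r (?H x) powr (1 + \<alpha>))"
          using Rx Cr by (simp add: K_def powr_mult)
        finally show ?thesis using fG K x by (simp add: w_def)
      next
        case False
        \<comment> \<open>Since i \<ge> 1, i/N is at least half of (i+1)/N and thus exceeds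
          \<epsilon>/2, which is at least 1/N0 = H(b).\<close>
        have "b \<le> ?p"
        proof (rule ccontr)
          assume "\<not> b \<le> ?p"
          then have "?H ?p < ?H b" using b pq by (intro cdf_of_less[OF h]) auto
          then have "real i / real N < 1 / real N0" using b g(4)[OF N, of i] i by simp
          also have "1 / real N0 \<le> \<epsilon> / 2" using N0 \<epsilon> by (simp add: field_simps)
          finally have "real i / real N < \<epsilon> / 2" .
          moreover have "(real i + 1) / real N \<le> 2 * (real i / real N)"
            using True N by (simp add: divide_right_mono)
          ultimately show False using False by linarith
        qed
        then have "G N i \<le> a * (V vm * (1 / h gm) powr (1 + \<alpha>))"
          unfolding G_def a_def using pq by (intro cell_contribution_le[OF h CB \<alpha> pq n] vm gm) auto
        then show ?thesis using fG w0 x by (simp add: w_def K'_def)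
      qed
    qed
  qed

  \<comment> \<open>Pointwise convergence\<close>
  have lim: "(\<lambda>N. f N x) \<longlonglongrightarrow> L x" for x
  proof (cases "x \<in> {0<..1}")
    case False
    then show ?thesis using f_out by (simp add: L_def)
  next
    case x: True
    have "\<exists>i. \<forall>N. 1 \<le> N \<longrightarrow> i N < N \<and> x \<in> cell N (i N)"
    proof (intro choice allI)
      fix N show "\<exists>i. 1 \<le> N \<longrightarrow> i < N \<and> x \<in> cell N i"
        using subdivision_cover[of "T N" x N] g[of N] x by (auto simp: cell_def)
    qed
    then obtain i where i: "\<And>N. 1 \<le> N \<Longrightarrow> i N < N \<and> x \<in> cell N (i N)" by blast
    have lim: "(\<lambda>N. G N (i N)) \<longlonglongrightarrow> 1 / ((1 + \<alpha>) * (2 + \<alpha>)) * (c x * h x powr (- (1 + \<alpha>)))"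
      unfolding G_def using i by (intro cell_contribution_tendsto(1)[OF h CB \<alpha> T x]) (auto simp: cell_def)
    \<comment> \<open>On the first cell \<open>f\<close> vanishes by construction, so it equals the
      cell height at x only once the cell of x has index at least 1.\<close>
    have "\<forall>\<^sub>F N in sequentially. 1 \<le> i N"
      using i by (intro cell_contribution_tendsto(2)[OF h CB \<alpha> T x]) (auto simp: cell_def)
    with eventually_ge_at_top[of 1] have "\<forall>\<^sub>F N in sequentially. G N (i N) = f N x"
    proof eventually_elim
      case (elim N)
      then show ?case using i[OF elim(1)] f_cell[OF elim(1), of "i N" x] by simp
    qed
    from Lim_transform_eventually[OF lim this] show ?thesis
      using x by (simp add: L_def a_def add.commute)
  qed

  \<comment> \<open>Passage to the limit under the integral\<close>
  have Lm[measurable]: "L \<in> borel_measurable borel"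
  proof -
    have "continuous_on {0<..1} (\<lambda>x. a * (c x * h x powr (- (1 + \<alpha>))))"
    proof (intro continuous_intros ballI qRS_densityD(1)[OF h])
      show "continuous_on {0<..1} c" using CB by (simp add: CB_class_def)
      show "h x \<noteq> 0" if "x \<in> {0<..1}" for x using qRS_densityD(2)[OF h that] by simp
    qed
    then have "(\<lambda>x. indicator {0<..1} x *\<^sub>R (a * (c x * h x powr (- (1 + \<alpha>))))) \<in> borel_measurable borel"
      by (intro borel_measurable_continuous_on_indicator) auto
    then show ?thesis by (simp add: L_def[abs_def])
  qed
  have wint: "integrable lebesgue w"
  proof -
    have "integrable lebesgue (\<lambda>x. K * (indicator {0<..1} x *\<^sub>R (R (?H x) * r (?H x) powr (1 + \<alpha>))) + indicator {0<..1} x * K')"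
      using assms(17) unfolding set_integrable_def
      by (intro Bochner_Integration.integrable_add integrable_mult_right integrable_mult_left integrable_real_indicator) auto
    then show ?thesis by (simp add: w_def[abs_def] distrib_left mult.left_commute)
  qed
  have "(\<lambda>N. \<integral>x. f N x \<partial>lebesgue) \<longlonglongrightarrow> (\<integral>x. L x \<partial>lebesgue)"
  proof (rule integral_dominated_convergence[where w = w])
    show "L \<in> borel_measurable lebesgue" using Lm by (intro measurable_completion) simp
    show "f N \<in> borel_measurable lebesgue" for N
      using fm by (intro measurable_completion) simp
  qed (use wint lim bound f0 in auto)
  also have "(\<integral>x. L x \<partial>lebesgue) = (\<integral>x. L x \<partial>lborel)"
    by (rule integral_completion) simp
  also have "\<dots> = 1 / ((1 + \<alpha>) * (2 + \<alpha>)) * (LBINT t:{0<..1}. c t * h t powr (- (1 + \<alpha>)))"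
    unfolding L_def set_lebesgue_integral_def a_def
    by (subst integral_mult_right_zero[symmetric], intro Bochner_Integration.integral_cong) (auto simp: add.commute)
  finally have "(\<lambda>N. real N powr (1 + \<alpha>) * ((T N 1 - T N 0)\<^sup>2 / 2 * mean_square_increment P X (T N 0) (T N 1)) + (\<integral>x. f N x \<partial>lebesgue))
      \<longlonglongrightarrow> 0 + 1 / ((1 + \<alpha>) * (2 + \<alpha>)) * (LBINT t:{0<..1}. c t * h t powr (- (1 + \<alpha>)))"
    using assms(5) by (intro tendsto_add first_cell_tendsto_0[OF h assms(8,3) _ T assms(18)]) auto
  then have "(\<lambda>N. real N powr (1 + \<alpha>) * ((T N 1 - T N 0)\<^sup>2 / 2 * mean_square_increment P X (T N 0) (T N 1)) + (\<integral>x. f N x \<partial>lebesgue))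
      \<longlonglongrightarrow> 1 / ((1 + \<alpha>) * (2 + \<alpha>)) * (LBINT t:{0<..1}. c t * h t powr (- (1 + \<alpha>)))"
    by simp
  then show ?thesis
    by (rule Lim_transform_eventually)
       (use err in \<open>auto intro: eventually_mono[OF eventually_ge_at_top[of 1]]\<close>)
qed

end
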